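(* Let $G$ be a finite simple graph on $n$ vertices, let \[\mathcal{G}' = \{\overline{K_4},\ K_2 \cup K_1 \cup K_1,\ K_2 \cup K_2 \cup K_1,\ K_2 \cup K_2 \cup K_2,\ K_2 \cup K_1,\ K_2 \cup K_2\},\] and let $\mathcal{G} = \{P_m \mid m \geq 2\} \cup \{C_m \mid m \geq 3\} \cup \mathcal{G}'$. Then $\operatorname{dmg}(G;2) = n-2$ if and only if $G$ is isomorphic to a member of $\mathcal{G}$.
   Context: All graphs are finite, undirected and simple, and need not be connected. $P_m$, $C_m$, $K_m$ denote the path, cycle and complete graph on $m$ vertices, $\overline{K_m}$ the graph with $m$ vertices and no edges, and $\cup$ denotes disjoint union of graphs. The game with one cop and $s$ robbers on a graph $G$ is a perfect-information game. In round $0$ the cop chooses an initial vertex, and then each robber chooses an initial vertex (several robbers may share a vertex). Each subsequent round consists of a turn for the cop followed by a turn for the robbers; on their turn, each player may stay put or move to a neighboring vertex (on the robbers' turn every uncaptured robber may do so). Whenever the cop occupies the same vertex as one or more robbers, all those robbers are captured and take no further part in the game. If a robber occupies a vertex $v$ at the end of some round (including round $0$) and that robber is not captured in the following round, then $v$ becomes damaged (and stays damaged). The robbers aim to maximize, and the cop aims to minimize, the total number of damaged vertices. The $s$-robber damage number $\operatorname{dmg}(G;s)$ is the number of vertices damaged under optimal play, i.e. the smallest $d$ such that the cop has a strategy guaranteeing that at most $d$ vertices are ever damaged, whatever the $s$ robbers do. *)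

theory Defs
  imports Main "HOL-Library.Nat_Bijection"
begin

section \<open>Finite simple graphs\<close>

record 'a ugraph =
  verts :: "'a set"
  edges :: "'a set set"

definition simple_graph :: "'a ugraph \<Rightarrow> bool" where
  "simple_graph G \<longleftrightarrow> finite (verts G) \<and> (\<forall>e\<in>edges G. e \<subseteq> verts G \<and> card e = 2)"

definition adjacent :: "'a ugraph \<Rightarrow> 'a \<Rightarrow> 'a \<Rightarrow> bool" where
  "adjacent G u v \<longleftrightarrow> {u, v} \<in> edges G"

definition isomorphic :: "'a ugraph \<Rightarrow> 'b ugraph \<Rightarrow> bool" (infix "\<cong>\<^sub>g" 50) where
  "G \<cong>\<^sub>g H \<longleftrightarrow> (\<exists>f. bij_betw f (verts G) (verts H) \<and>
     (\<forall>u\<in>verts G. \<forall>v\<in>verts G. adjacent G u v \<longleftrightarrow> adjacent H (f u) (f v)))"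

definition path_graph :: "nat \<Rightarrow> nat ugraph" where
  "path_graph m = \<lparr>verts = {..<m}, edges = {{i, Suc i} | i. Suc i < m}\<rparr>"

text \<open>The edge set below is that of a cycle only for \<open>m \<ge> 3\<close>.\<close>

definition cycle_graph :: "nat \<Rightarrow> nat ugraph" where
  "cycle_graph m = \<lparr>verts = {..<m}, edges = {{i, Suc i mod m} | i. i < m}\<rparr>"

definition complete_graph :: "nat \<Rightarrow> nat ugraph" where
  "complete_graph m = \<lparr>verts = {..<m}, edges = {e. e \<subseteq> {..<m} \<and> card e = 2}\<rparr>"

definition empty_graph :: "nat \<Rightarrow> nat ugraph" where
  "empty_graph m = \<lparr>verts = {..<m}, edges = {}\<rparr>"

text \<open>The disjoint union is relabelled along the bijection \<open>sum_encode\<close> from \<open>nat + nat\<close>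
  to \<open>nat\<close>, so that it is again a graph on natural numbers.\<close>

definition disjoint_union :: "nat ugraph \<Rightarrow> nat ugraph \<Rightarrow> nat ugraph" (infixl "\<union>\<^sub>g" 65) where
  "G \<union>\<^sub>g H =
     \<lparr>verts = sum_encode ` (verts G <+> verts H),
      edges = (\<lambda>e. sum_encode ` Inl ` e) ` edges G \<union> (\<lambda>e. sum_encode ` Inr ` e) ` edges H\<rparr>"


section \<open>The game with one cop and several robbers\<close>

text \<open>A configuration of the \<open>s\<close> robbers at the end of a round is a list of length \<open>s\<close>;
  its \<open>i\<close>-th entry is \<open>Some v\<close> if robber \<open>i\<close> is at \<open>v\<close>, and \<open>None\<close> if it has been captured.\<close>

type_synonym 'a config = "'a option list"

text \<open>A cop strategy \<open>\<sigma>\<close> maps the list of the robbers' configurations at the end of rounds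
  \<open>0, \<dots>, t - 1\<close> to the position of the cop in round \<open>t\<close>; in particular \<open>\<sigma> []\<close> is the initial
  vertex. The cop's own earlier positions need not be recorded, since they are determined by
  \<open>\<sigma>\<close> and the prefixes of the list.\<close>

type_synonym 'a strategy = "'a config list \<Rightarrow> 'a"

definition may_move :: "'a ugraph \<Rightarrow> 'a \<Rightarrow> 'a \<Rightarrow> bool" where
  "may_move G u v \<longleftrightarrow> v = u \<or> adjacent G u v"

definition cop_strategy :: "'a ugraph \<Rightarrow> 'a strategy \<Rightarrow> bool" where
  "cop_strategy G \<sigma> \<longleftrightarrow> \<sigma> [] \<in> verts G \<and> (\<forall>h \<rho>. may_move G (\<sigma> h) (\<sigma> (h @ [\<rho>])))"

definition cop_pos :: "'a strategy \<Rightarrow> (nat \<Rightarrow> 'a config) \<Rightarrow> nat \<Rightarrow> 'a" where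
  "cop_pos \<sigma> r t = \<sigma> (map r [0..<t])"

text \<open>The status of a robber who chooses vertex \<open>v\<close> on the robbers' turn while the cop is at \<open>c\<close>.\<close>

definition status :: "'a \<Rightarrow> 'a \<Rightarrow> 'a option" where
  "status c v = (if v = c then None else Some v)"

definition robber_start :: "'a ugraph \<Rightarrow> 'a \<Rightarrow> 'a option \<Rightarrow> bool" where
  "robber_start G c x \<longleftrightarrow> (\<exists>v\<in>verts G. x = status c v)"

text \<open>One round for a single robber, whose status changes from the first to the second option;
  \<open>c\<close> is the position of the cop after the cop's turn of this round.\<close>

fun robber_step :: "'a ugraph \<Rightarrow> 'a \<Rightarrow> 'a option \<Rightarrow> 'a option \<Rightarrow> bool" where
  "robber_step G c None x \<longleftrightarrow> x = None"
| "robber_step G c (Some u) x \<longleftrightarrow>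
     (if u = c then x = None else (\<exists>v. may_move G u v \<and> x = status c v))"

definition robber_play :: "'a ugraph \<Rightarrow> nat \<Rightarrow> 'a strategy \<Rightarrow> (nat \<Rightarrow> 'a config) \<Rightarrow> bool" where
  "robber_play G s \<sigma> r \<longleftrightarrow>
     (\<forall>t. length (r t) = s) \<and>
     (\<forall>i<s. robber_start G (cop_pos \<sigma> r 0) (r 0 ! i)) \<and>
     (\<forall>t. \<forall>i<s. robber_step G (cop_pos \<sigma> r (Suc t)) (r t ! i) (r (Suc t) ! i))"

definition damaged :: "nat \<Rightarrow> (nat \<Rightarrow> 'a config) \<Rightarrow> 'a set" where
  "damaged s r = {v. \<exists>t. \<exists>i<s. r t ! i = Some v \<and> r (Suc t) ! i \<noteq> None}"

definition dmg :: "'a ugraph \<Rightarrow> nat \<Rightarrow> nat" where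
  "dmg G s = (LEAST d. \<exists>\<sigma>. cop_strategy G \<sigma> \<and>
     (\<forall>r. robber_play G s \<sigma> r \<longrightarrow> card (damaged s r) \<le> d))"


section \<open>The exceptional families\<close>

definition small_family :: "nat ugraph set" where
  "small_family =
     {empty_graph 4,
      complete_graph 2 \<union>\<^sub>g complete_graph 1 \<union>\<^sub>g complete_graph 1,
      complete_graph 2 \<union>\<^sub>g complete_graph 2 \<union>\<^sub>g complete_graph 1,
      complete_graph 2 \<union>\<^sub>g complete_graph 2 \<union>\<^sub>g complete_graph 2,
      complete_graph 2 \<union>\<^sub>g complete_graph 1,
      complete_graph 2 \<union>\<^sub>g complete_graph 2}"

definition extremal_family :: "nat ugraph set" where
  "extremal_family =
     {path_graph m | m. m \<ge> 2} \<union> {cycle_graph m | m. m \<ge> 3} \<union> small_family"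

end

theory Submission
  imports Defs
begin

text \<open>
  Upper bounds. The cop guards a vertex \<open>v\<close>: she stays on \<open>v\<close> until a robber enters a neighbour of
  \<open>v\<close>, captures one, and walks back. Only the second robber can then damage neighbours of \<open>v\<close>,
  and a suitable choice of the first target leaves at least three vertices of the closed
  neighbourhood undamaged if \<open>v\<close> has degree at least 3, and two of them in degree 1 and 2. In degree 2
  the missing third vertex is gained as soon as the graph is disconnected: either one robber
  is never in the component of \<open>v\<close>, or the other components stay undamaged. Hence a graph
  attaining \<open>n - 2\<close> is a path, a cycle, or has maximum degree at most 1, and in the last case it is
  covered by three closed neighbourhoods.

  Lower bounds. On a path and on a cycle one robber \<open>R\<close> keeps following the cop at
  distance 2 while the other robber \<open>L\<close> sweeps the rest of the graph towards the cop from the other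
  side. When only the cop's vertex and its two neighbours are left, \<open>L\<close> steps next to the cop: if the cop
  captures \<open>L\<close>, then \<open>R\<close> damages the vertex on the other side.
\<close>

section \<open>Guarding a vertex\<close>

text \<open>Three undamaged vertices refute \<open>n - 2\<close>, and they are counted in the closed
  neighbourhood of \<open>v\<close>. There \<open>v\<close> and the vertex of the first capture are
  spared, and the other robber gets at most two damaging rounds before the cop is back. So degree at
  least 4 is immediate, and only degree 3 depends on which robber is captured first.

  A cop strategy is an arbitrary function of the history, so a lower bound cannot fix the robbers'
  play in advance. The inductive predicate \<open>wins\<close> quantifies over the cop's next
  position only and accumulates the damaged set; strategies and infinite plays enter once, in
  \<open>wins_play\<close>. Working with positions also makes it easy to transport wins along
  isomorphisms, including the reflection of a path.

  The obstacle on a path is its end, where the cop can trap R. If she starts in the left half, that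
  chase takes so long that L can finish alone. A cycle has no such trap; only the triangle is
  separate, since there the vertices before the cop and two after her coincide.\<close>

definition nbrs :: "'a ugraph \<Rightarrow> 'a \<Rightarrow> 'a set" where
  "nbrs G v = {u. adjacent G v u}"

text \<open>Among vertex sets these are the unions of connected components. They stand in for
  connectivity throughout.\<close>

definition adj_closed :: "'a ugraph \<Rightarrow> 'a set \<Rightarrow> bool" where
  "adj_closed G C \<longleftrightarrow> (\<forall>u\<in>C. nbrs G u \<subseteq> C)"

lemma mem_nbrs [simp]: "u \<in> nbrs G v \<longleftrightarrow> adjacent G v u"
  by (simp add: nbrs_def)

lemma adjacent_sym: "adjacent G u v \<longleftrightarrow> adjacent G v u"
  by (simp add: adjacent_def insert_commute)

lemma adjacent_vertsD:
  assumes "simple_graph G" "adjacent G u v"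
  shows "u \<in> verts G" "v \<in> verts G" "u \<noteq> v"
proof -
  have "{u, v} \<subseteq> verts G \<and> card {u, v} = 2"
    using assms unfolding simple_graph_def adjacent_def by blast
  then show "u \<in> verts G" "v \<in> verts G" "u \<noteq> v"
    by (auto simp: card_insert_if split: if_splits)
qed

lemma nbrs_subset_verts: "simple_graph G \<Longrightarrow> nbrs G v \<subseteq> verts G"
  using adjacent_vertsD by fastforce

lemma finite_verts: "simple_graph G \<Longrightarrow> finite (verts G)"
  by (simp add: simple_graph_def)

lemma finite_nbrs: "simple_graph G \<Longrightarrow> finite (nbrs G v)"
  using nbrs_subset_verts finite_verts finite_subset by metis

text \<open>Together with \<open>play_closed\<close> this says that a robber who starts outside
  \<open>C\<close> never enters it.\<close>

lemma adj_closed_Compl: "adj_closed G C \<Longrightarrow> adj_closed G (- C)"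
  using adjacent_sym by (fastforce simp: adj_closed_def)

lemma card_insert_nbrs:
  assumes "simple_graph G"
  shows "card (insert v (nbrs G v)) = Suc (card (nbrs G v))"
proof -
  have "v \<notin> nbrs G v" using adjacent_vertsD(3)[OF assms, of v v] by auto
  then show ?thesis using finite_nbrs[OF assms] by simp
qed

lemma robber_step_None: "robber_step G c x x' \<Longrightarrow> x = None \<Longrightarrow> x' = None"
  by simp

lemma robber_step_SomeE:
  assumes "robber_step G c x (Some w)"
  obtains u where "x = Some u" "u \<noteq> c" "may_move G u w" "w \<noteq> c"
  using assms by (cases x) (auto simp: status_def split: if_splits)

section \<open>Invariants of a single play\<close>

context
  fixes G :: "'a ugraph" and s :: nat and \<sigma> r
  assumes G: "simple_graph G" and play: "robber_play G s \<sigma> r"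
begin

lemma play_step: "i < s \<Longrightarrow> robber_step G (cop_pos \<sigma> r (Suc t)) (r t ! i) (r (Suc t) ! i)"
  using play by (simp add: robber_play_def)

lemma play_start: "i < s \<Longrightarrow> \<exists>v\<in>verts G. r 0 ! i = status (cop_pos \<sigma> r 0) v"
  using play by (simp add: robber_play_def robber_start_def)

lemma play_None_mono: 
  assumes "i < s" "t \<le> t'" "r t ! i = None" 
  shows "r t' ! i = None"
  using assms(2,3) by (induction rule: dec_induct) (use play_step[OF assms(1)] robber_step_None in metis)+

lemma play_verts: 
  assumes "i < s" "r t ! i = Some w"
  shows "w \<in> verts G"
  using assms(2)
proof (induction t arbitrary: w)
  case 0
  then show ?case using play_start[OF assms(1)] by (auto simp: status_def split: if_splits)
next
  case (Suc t)
  from play_step[OF assms(1), of t] Suc.prems obtain u where "r t ! i = Some u" "may_move G u w"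
    by (metis robber_step_SomeE)
  then show ?case using Suc.IH adjacent_vertsD[OF G] by (auto simp: may_move_def)
qed

lemma play_not_cop:
  assumes "i < s" "r t ! i = Some w"
  shows "w \<noteq> cop_pos \<sigma> r t"
proof (cases t)
  case 0
  then show ?thesis using play_start[OF assms(1)] assms(2) by (auto simp: status_def split: if_splits)
next
  case (Suc t')
  then show ?thesis using play_step[OF assms(1), of t'] assms(2) by (metis robber_step_SomeE)
qed

lemma play_captured:
  assumes "i < s" "r t ! i = Some w" "cop_pos \<sigma> r (Suc t) = w"
  shows "r (Suc t) ! i = None"
  using play_step[OF assms(1), of t] assms(2,3) by simp

lemma play_closed:
  assumes "i < s" "adj_closed G C" "r 0 ! i = Some u" "u \<in> C" "r t ! i = Some w"
  shows "w \<in> C"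
  using assms(5)
proof (induction t arbitrary: w)
  case 0
  then show ?case using assms by simp
next
  case (Suc t)
  from play_step[OF assms(1), of t] Suc.prems obtain u where "r t ! i = Some u" "may_move G u w"
    by (metis robber_step_SomeE)
  then show ?case using Suc.IH assms(2) by (auto simp: may_move_def adj_closed_def subset_iff)
qed

lemma play_start_Some:
  assumes "i < s" "r t ! i = Some w"
  obtains u where "r 0 ! i = Some u" "u \<in> verts G"
  using play_None_mono[OF assms(1), of 0 t] play_verts[OF assms(1), of 0] assms(2) by fastforce

lemma damaged_subset_verts: "damaged s r \<subseteq> verts G"
  using play_verts by (auto simp: damaged_def)

end

section \<open>Bounding the damage number from above and below\<close>

lemma dmg_le:
  assumes "cop_strategy G \<sigma>" "\<And>r. robber_play G s \<sigma> r \<Longrightarrow> card (damaged s r) \<le> d"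
  shows "dmg G s \<le> d"
  unfolding dmg_def by (rule Least_le) (use assms in blast)

text \<open>\<open>dmg\<close> is a \<open>LEAST\<close>, so it has its defining property only if
  some value does. The cop who never moves provides one, \<open>card (verts G)\<close>.\<close>

lemma dmg_ge:
  assumes "simple_graph G" "verts G \<noteq> {}"
    and "\<And>\<sigma>. cop_strategy G \<sigma> \<Longrightarrow> \<exists>r. robber_play G s \<sigma> r \<and> d \<le> card (damaged s r)"
  shows "d \<le> dmg G s"
proof -
  let ?P = "\<lambda>d. \<exists>\<sigma>. cop_strategy G \<sigma> \<and> (\<forall>r. robber_play G s \<sigma> r \<longrightarrow> card (damaged s r) \<le> d)"
  obtain v where "v \<in> verts G" using assms(2) by blast
  then have "cop_strategy G (\<lambda>h. v)" by (simp add: cop_strategy_def may_move_def)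
  moreover have "card (damaged s r) \<le> card (verts G)" if "robber_play G s (\<lambda>h. v) r" for r
    by (rule card_mono) (use assms(1) that damaged_subset_verts finite_verts in blast)+
  ultimately have "?P (card (verts G))" by blast
  then have "?P (dmg G s)" unfolding dmg_def by (rule LeastI)
  then show ?thesis using assms(3) le_trans by blast
qed

text \<open>If the cop on \<open>v\<close> captures a robber on the neighbour \<open>u\<close>, a robber on the neighbour \<open>y\<close> damages
  \<open>y\<close> and may flee to a third neighbour \<open>z\<close> of \<open>v\<close>, out of reach from \<open>u\<close>. If \<open>v\<close> has degree 3, one of
  the two orders of capture excludes this.\<close>

definition evades :: "'a ugraph \<Rightarrow> 'a \<Rightarrow> 'a \<Rightarrow> 'a \<Rightarrow> bool" where
  "evades G v u y \<longleftrightarrow>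
     (\<exists>z. adjacent G v z \<and> z \<noteq> u \<and> z \<noteq> y \<and> adjacent G y z \<and> \<not> adjacent G u z)"

definition targets :: "'a ugraph \<Rightarrow> 'a \<Rightarrow> 'a config \<Rightarrow> 'a set" where
  "targets G p \<rho> = {u. Some u \<in> set \<rho> \<and> adjacent G p u}"

definition good_target :: "'a ugraph \<Rightarrow> 'a \<Rightarrow> 'a set \<Rightarrow> 'a \<Rightarrow> bool" where
  "good_target G v T u \<longleftrightarrow> (\<forall>y\<in>T. y \<noteq> u \<longrightarrow> \<not> evades G v u y)"

text \<open>Targets are sought around the cop's present position \<open>p\<close>, not around
  \<open>v\<close>, so after a capture she takes a robber next to her before walking back. The final
  \<open>p\<close> covers waiting on \<open>v\<close>, and also the case that the second capture has
  led her out of reach of \<open>v\<close>.\<close>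

definition guard_move :: "'a ugraph \<Rightarrow> 'a \<Rightarrow> 'a \<Rightarrow> 'a config \<Rightarrow> 'a" where
  "guard_move G v p \<rho> =
     (let T = targets G p \<rho> in
      if T \<noteq> {} then SOME u. u \<in> T \<and> ((\<exists>u\<in>T. good_target G v T u) \<longrightarrow> good_target G v T u)
      else if adjacent G p v then v else p)"

text \<open>A strategy sees only the robbers' configurations; the fold recomputes the cop's own
  position from them.\<close>

definition guard :: "'a ugraph \<Rightarrow> 'a \<Rightarrow> 'a strategy" where
  "guard G v h = foldl (guard_move G v) v h"

lemma guard_move_target:
  assumes "targets G p \<rho> \<noteq> {}"
  shows "guard_move G v p \<rho> \<in> targets G p \<rho>"
    and "\<lbrakk>u \<in> targets G p \<rho>; good_target G v (targets G p \<rho>) u\<rbrakk>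
      \<Longrightarrow> good_target G v (targets G p \<rho>) (guard_move G v p \<rho>)"
proof -
  let ?T = "targets G p \<rho>"
  have "\<exists>u. u \<in> ?T \<and> ((\<exists>u\<in>?T. good_target G v ?T u) \<longrightarrow> good_target G v ?T u)"
    using assms by blast
  from someI_ex[OF this]
  have "guard_move G v p \<rho> \<in> ?T \<and>
      ((\<exists>u\<in>?T. good_target G v ?T u) \<longrightarrow> good_target G v ?T (guard_move G v p \<rho>))"
    unfolding guard_move_def Let_def if_P[OF assms] .
  then show "guard_move G v p \<rho> \<in> ?T"
    and "\<lbrakk>u \<in> ?T; good_target G v ?T u\<rbrakk> \<Longrightarrow> good_target G v ?T (guard_move G v p \<rho>)"
    by blast+
qed

lemma guard_move_no_target:
  assumes "targets G p \<rho> = {}"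
  shows "guard_move G v p \<rho> = (if adjacent G p v then v else p)"
  using assms by (simp add: guard_move_def)

lemma cop_strategy_guard:
  assumes "v \<in> verts G"
  shows "cop_strategy G (guard G v)"
proof -
  have "may_move G p (guard_move G v p \<rho>)" for p \<rho>
    using guard_move_target(1)[of G p \<rho> v] guard_move_no_target[of G p \<rho> v]
    by (cases "targets G p \<rho> = {}") (auto simp: may_move_def targets_def)
  then show ?thesis using assms by (simp add: cop_strategy_def guard_def)
qed

text \<open>Before the first time \<open>t0\<close> at which a robber is next to \<open>v\<close>,
  nothing in the closed neighbourhood is damaged. Then robber \<open>j\<close> is captured on
  \<open>u\<close>, and from time \<open>t0 + 2\<close> on the other robber \<open>i\<close> is
  captured too or faces a cop on \<open>v\<close>, who captures it whenever it comes next to her. So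
  damage there stems from the positions of \<open>i\<close> at times \<open>t0\<close> and
  \<open>t0 + 1\<close>, collected in \<open>S\<close>; if \<open>S\<close> is nonempty, both
  robbers have visited the neighbourhood.\<close>

lemma guard_damage:
  assumes G: "simple_graph G" and v: "v \<in> verts G" and play: "robber_play G 2 (guard G v) r"
  obtains u S where "damaged 2 r \<inter> insert v (nbrs G v) \<subseteq> S" "S \<subseteq> nbrs G v - {u}"
    "S \<noteq> {} \<longrightarrow> adjacent G v u" "card S \<le> 2" "card (nbrs G v) = 3 \<longrightarrow> card S \<le> 1"
    "S \<noteq> {} \<longrightarrow> (\<forall>i<2. \<exists>t. \<exists>w\<in>nbrs G v. r t ! i = Some w)"
proof -
  define P where "P = cop_pos (guard G v) r"
  note step = play_step[OF G play, folded P_def]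
  note mono = play_None_mono[OF G play]
  note notcop = play_not_cop[OF G play, folded P_def]
  note capt = play_captured[OF G play, folded P_def]
  have P0: "P 0 = v" by (simp add: P_def cop_pos_def guard_def)
  have PSuc: "P (Suc t) = guard_move G v (P t) (r t)" for t
    by (simp add: P_def cop_pos_def guard_def)
  have len: "length (r t) = 2" for t using play by (simp add: robber_play_def)
  have targets: "u \<in> targets G p (r t) \<longleftrightarrow> adjacent G p u \<and> (\<exists>i<2. r t ! i = Some u)" for u p t
    by (auto simp: targets_def in_set_conv_nth len)
  let ?near = "\<lambda>t. \<exists>i<2. \<exists>w\<in>nbrs G v. r t ! i = Some w"
  have at_v: "P t = v" if "\<And>t'. t' < t \<Longrightarrow> \<not> ?near t'" for t
    using that
  proof (induction t)
    case (Suc t)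
    then have "P t = v" "\<not> ?near t" by simp_all
    then have "targets G (P t) (r t) = {}" using targets by auto
    then show ?case using \<open>P t = v\<close> by (simp add: PSuc guard_move_no_target)
  qed (simp add: P0)
  show thesis
  proof (cases "\<exists>t. ?near t")
    case False
    then have "P t = v" for t using at_v by blast
    then have "damaged 2 r \<inter> insert v (nbrs G v) \<subseteq> {}"
      using False notcop by (fastforce simp: damaged_def)
    then show thesis by (intro that[of "{}" v]) auto
  next
    case True
    define t0 where "t0 = (LEAST t. ?near t)"
    have near: "?near t0" unfolding t0_def using True by (rule LeastI_ex)
    have before: "\<not> ?near t" if "t < t0" for t using that not_less_Least unfolding t0_def by blast
    have Pt: "P t = v" if "t \<le> t0" for t using at_v before that by simp
    define u where "u = P (Suc t0)"
    define T where "T = targets G v (r t0)"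
    have T_ne: "T \<noteq> {}" using near unfolding T_def by (force simp: targets)
    then have uT: "u \<in> T" using guard_move_target(1) Pt unfolding u_def T_def PSuc by fastforce
    then obtain j where j: "j < 2" "r t0 ! j = Some u" and vu: "adjacent G v u"
      unfolding T_def by (auto simp: targets)
    have jN: "r t ! j = None" if "Suc t0 \<le> t" for t
      using capt[OF j] mono[OF j(1) that] u_def by simp
    define i where "i = 1 - j"
    have i: "i < 2" and ij: "k < 2 \<longleftrightarrow> k = i \<or> k = j" for k using j(1) by (auto simp: i_def)
    have ex2: "(\<exists>k<2. r t ! k = Some x) \<longleftrightarrow> r t ! i = Some x \<or> r t ! j = Some x" for t x
      by (simp only: ij) blast
    have single: "targets G p (r t) = {w}"
      if "Suc t0 \<le> t" "r t ! i = Some w" "adjacent G p w" for p t w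
      unfolding set_eq_iff targets ex2 using jN[OF that(1)] that(2,3) by auto
    \<comment> \<open>From here on the cop ends a turn away from \<open>v\<close> only by capturing
      a robber, and only \<open>i\<close> can be left.\<close>
    have later: "r t ! i = None \<or> P t = v" if "Suc (Suc t0) \<le> t" for t
      using that
    proof (induction t rule: dec_induct)
      case base
      show ?case
      proof (cases "targets G u (r (Suc t0)) = {}")
        case True
        then show ?thesis using vu
          by (simp add: PSuc[of "Suc t0"] u_def[symmetric] guard_move_no_target adjacent_sym)
      next
        case False
        then have "P (Suc (Suc t0)) \<in> targets G u (r (Suc t0))"
          unfolding PSuc[of "Suc t0"] u_def[symmetric] by (rule guard_move_target(1))
        then obtain k where "k < 2" "r (Suc t0) ! k = Some (P (Suc (Suc t0)))"
          by (auto simp: targets)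
        then show ?thesis using capt jN ij by fastforce
      qed
    next
      case (step t)
      show ?case
      proof (cases "r t ! i")
        case None
        then show ?thesis using mono[OF i, of t "Suc t"] by simp
      next
        case (Some w)
        then have Pv: "P t = v" using step.IH by simp
        have jt: "r t ! j = None" using jN step.hyps by simp
        show ?thesis
        proof (cases "targets G v (r t) = {}")
          case True
          then show ?thesis using Pv by (simp add: PSuc guard_move_no_target)
        next
          case False
          then have "P (Suc t) \<in> targets G v (r t)"
            unfolding PSuc Pv by (rule guard_move_target(1))
          then obtain k where "k < 2" "r t ! k = Some (P (Suc t))"
            by (auto simp: targets)
          then show ?thesis using capt jt ij by fastforce
        qed
      qed
    qed
    have later_far: "w \<notin> insert v (nbrs G v)"
      if "Suc (Suc t0) \<le> t" "r t ! i = Some w" "r (Suc t) ! i \<noteq> None" for t w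
    proof
      assume w: "w \<in> insert v (nbrs G v)"
      have Pv: "P t = v" using later[OF that(1)] that(2) by simp
      have "w \<noteq> v" using notcop[OF i that(2)] Pv by simp
      then have vw: "adjacent G v w" using w by simp
      then have "targets G v (r t) = {w}" using single[of t w v] that by simp
      then have "P (Suc t) = w" using guard_move_target(1)[of G v "r t" v] Pv by (simp add: PSuc)
      then show False using capt[OF i that(2)] that(3) by simp
    qed
    \<comment> \<open>This is the reason for the clause about non-adjacency to \<open>u\<close> in
      \<open>evades\<close>: next to \<open>u\<close> the robber is captured before it does
      damage.\<close>
    have catch: "r (Suc (Suc t0)) ! i = None" if "r (Suc t0) ! i = Some w" "adjacent G u w" for w
    proof -
      have "targets G u (r (Suc t0)) = {w}" using single[of "Suc t0" w u] that by simp
      then have "P (Suc (Suc t0)) = w"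
        using guard_move_target(1)[of G u "r (Suc t0)" v] by (simp add: PSuc[of "Suc t0"] u_def[symmetric])
      then show ?thesis using capt[OF i that(1)] by simp
    qed
    define S where "S = {w \<in> insert v (nbrs G v).
      r t0 ! i = Some w \<and> r (Suc t0) ! i \<noteq> None \<or> r (Suc t0) ! i = Some w \<and> r (Suc (Suc t0)) ! i \<noteq> None}"
    have S1: "damaged 2 r \<inter> insert v (nbrs G v) \<subseteq> S"
    proof
      fix w assume "w \<in> damaged 2 r \<inter> insert v (nbrs G v)"
      then obtain t k where w: "w \<in> insert v (nbrs G v)" and k: "k < 2" "r t ! k = Some w" 
          "r (Suc t) ! k \<noteq> None"
        by (auto simp: damaged_def)
      have "\<not> t < t0"
        using before[of t] k w notcop[OF k(1,2)] Pt[of t] by (metis insertE less_imp_le)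
      have "k = i"
        using jN[of "Suc t"] k ij \<open>\<not> t < t0\<close> by (metis Suc_le_mono not_less)
      have "\<not> Suc (Suc t0) \<le> t" using later_far k w \<open>k = i\<close> by blast
      with \<open>\<not> t < t0\<close> have "t = t0 \<or> t = Suc t0" by linarith
      with k w \<open>k = i\<close> show "w \<in> S" unfolding S_def by blast
    qed
    have S2: "S \<subseteq> nbrs G v - {u}"
    proof
      fix w assume wS: "w \<in> S"
      \<comment> \<open>The cop occupies \<open>v\<close> at time \<open>t0\<close> and is next to
        it, on \<open>u\<close>, one round later. A robber on \<open>u\<close> at time
        \<open>t0\<close> shares the fate of \<open>j\<close>, and at the next time the cop herself
        is on \<open>u\<close>.\<close>
      have "w \<noteq> v"
        using wS notcop[OF i, of t0 w] Pt[of t0] catch[of v] vu 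
        unfolding S_def by (auto simp: adjacent_sym)
      moreover have "w \<noteq> u"
        using wS notcop[OF i, of "Suc t0" w] capt[OF i, of t0 w] unfolding S_def u_def by auto
      ultimately show "w \<in> nbrs G v - {u}" using wS unfolding S_def by auto
    qed
    have S3: "S \<subseteq> set_option (r t0 ! i) \<union> set_option (r (Suc t0) ! i)" 
      unfolding S_def by auto
    have S4: "card S \<le> 2"
    proof -
      have "card S \<le> card (set_option (r t0 ! i) \<union> set_option (r (Suc t0) ! i))"
        by (rule card_mono[OF _ S3]) simp
      also have "\<dots> \<le> 2" by (cases "r t0 ! i"; cases "r (Suc t0) ! i") (simp_all add: card_insert_if)
      finally show ?thesis .
    qed
    have S5: "card S \<le> 1" if deg: "card (nbrs G v) = 3"
    proof (rule ccontr)
      assume "\<not> card S \<le> 1"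
      then have "card S = 2" using S4 by simp
      then obtain x y where xy: "S = {x, y}" "x \<noteq> y" by (auto simp: card_2_iff)
      have "r t0 ! i = Some x \<or> r (Suc t0) ! i = Some x" "r t0 ! i = Some y \<or> r (Suc t0) ! i = Some y"
        using S3 unfolding xy(1) by (auto simp: elem_set)
      with xy obtain w0 w1 where w: "r t0 ! i = Some w0" "r (Suc t0) ! i = Some w1" "w0 \<noteq> w1" 
          "w0 \<in> S" "w1 \<in> S"
        by (metis insertI1 insertI2 option.inject)
      have nb: "adjacent G v w0" "adjacent G v w1" "w0 \<noteq> u" "w1 \<noteq> u" using S2 w by auto
      have w01: "adjacent G w0 w1"
        using step[OF i, of t0] w by (auto simp: may_move_def status_def split: if_splits)
      have uw1: "\<not> adjacent G u w1" using catch[OF w(2)] w unfolding S_def by auto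
      \<comment> \<open>Damaging both \<open>w0\<close> and \<open>w1\<close> makes \<open>u\<close>
        a bad target. Then \<open>w0\<close> was bad as well, since a good target would have been
        preferred. Its escape vertex \<open>z\<close> is a fourth neighbour of \<open>v\<close>:
        unlike \<open>w1\<close>, it is not adjacent to \<open>w0\<close>.\<close>
      have "T = {u, w0}" unfolding T_def set_eq_iff targets ex2 using nb(1) vu w(1) j(2) by auto
      moreover have "evades G v u w0" using nb w01 uw1 w(3) by (auto simp: evades_def)
      ultimately have "\<not> good_target G v T u" using nb by (simp add: good_target_def)
      then have "\<not> good_target G v T w0"
        using guard_move_target(2)[of G v "r t0" w0 v] T_ne nb w i Pt[of t0]
        unfolding T_def[symmetric] u_def PSuc \<open>T = {u, w0}\<close> by auto
      then have "evades G v w0 u" using \<open>T = {u, w0}\<close> by (auto simp: good_target_def)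
      then obtain z where z: "adjacent G v z" "z \<noteq> w0" "z \<noteq> u" "\<not> adjacent G w0 z"
        by (auto simp: evades_def)
      moreover have "z \<noteq> w1" using z(4) w01 by blast
      ultimately have "card {u, w0, w1, z} = 4" using nb w(3) by auto
      moreover have "card {u, w0, w1, z} \<le> card (nbrs G v)"
        by (rule card_mono[OF finite_nbrs[OF G]]) (use nb z vu in auto)
      ultimately show False using deg by simp
    qed
    have S6: "\<exists>t. \<exists>w\<in>nbrs G v. r t ! k = Some w" if "S \<noteq> {}" "k < 2" for k
    proof (cases "k = j")
      case True
      then show ?thesis using j(2) vu by (intro exI[of _ t0] bexI[of _ u]) simp_all
    next
      case False
      then have "k = i" using ij that by blast
      moreover obtain w where "w \<in> S" using \<open>S \<noteq> {}\<close> by blast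
      then have "w \<in> nbrs G v" "r t0 ! i = Some w \<or> r (Suc t0) ! i = Some w"
        using S2 S3 by (auto simp: elem_set)
      ultimately show ?thesis by blast
    qed
    show thesis by (rule that[OF S1 S2]) (use vu S4 S5 S6 in auto)
  qed
qed

section \<open>A win condition for the robbers\<close>

text \<open>What one robber contributes to \<open>damaged\<close> in one round: its old vertex
  counts only if it survives the round.\<close>

definition hit :: "'a option \<Rightarrow> 'a option \<Rightarrow> 'a set" where
  "hit x x' = (if x' = None then {} else set_option x)"

lemma hit_simps [simp]: "hit x None = {}" "hit None x' = {}" "hit (Some u) (Some w) = {u}"
  by (simp_all add: hit_def)

text \<open>From the end of a round with the cop on \<open>p\<close>, robbers \<open>x\<close> and \<open>y\<close>, and \<open>D\<close> already damaged, the
  robbers can in finitely many rounds reach a state with at most \<open>k\<close> undamaged vertices.\<close>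

inductive wins :: "'a ugraph \<Rightarrow> nat \<Rightarrow> 'a \<Rightarrow> 'a option \<Rightarrow> 'a option \<Rightarrow> 'a set \<Rightarrow> bool" for G k where
  wins_done: "card (verts G - D) \<le> k \<Longrightarrow> wins G k p x y D"
| wins_step: "(\<And>p'. may_move G p p' \<Longrightarrow>
      \<exists>x' y'. robber_step G p' x x' \<and> robber_step G p' y y' \<and>
        wins G k p' x' y' (D \<union> hit x x' \<union> hit y y')) \<Longrightarrow> wins G k p x y D"

definition robbers_leave :: "'a ugraph \<Rightarrow> nat \<Rightarrow> bool" where
  "robbers_leave G k \<longleftrightarrow> (\<forall>c\<in>verts G. \<exists>x y. robber_start G c x \<and> robber_start G c y \<and> wins G k c x y {})"

definition stay :: "'a \<Rightarrow> 'a option \<Rightarrow> 'a option" where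
  "stay c x = (case x of None \<Rightarrow> None | Some u \<Rightarrow> status c u)"

lemma robber_step_stay: "robber_step G c x (stay c x)"
  by (cases x) (auto simp: stay_def status_def may_move_def)

text \<open>The cop's next position depends on the play so far, so the play is defined by recursion
  on histories: each \<open>Hs n\<close> extends the previous one by a round of waiting, and
  \<open>r\<close> is their limit. It completes a finite winning sequence to an infinite
  play.\<close>

lemma stay_play:
  fixes \<sigma> :: "'a strategy"
  shows "\<exists>r. map r [0..<Suc (length h)] = h @ [\<rho>] \<and>
    (\<forall>t\<ge>length h. r (Suc t) = map (stay (\<sigma> (map r [0..<Suc t]))) (r t))"
proof -
  define f where "f H = H @ [map (stay (\<sigma> H)) (last H)]" for H :: "'a config list"
  define Hs where "Hs n = (f ^^ n) (h @ [\<rho>])" for n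
  have HsSuc: "Hs (Suc n) = Hs n @ [map (stay (\<sigma> (Hs n))) (last (Hs n))]" for n
    by (simp add: Hs_def f_def)
  have len: "length (Hs n) = Suc (length h) + n" for n
    by (induction n) (simp_all add: HsSuc, simp add: Hs_def)
  have stable: "t < length (Hs n) \<Longrightarrow> Hs (n + k) ! t = Hs n ! t" for n k t
    by (induction k) (auto simp: HsSuc nth_append len)
  define r where "r t = Hs t ! t" for t
  have r_nth: "r t = Hs n ! t" if "t < length (Hs n)" for t n
  proof (cases "n \<le> t")
    case True
    then show ?thesis using stable[of t n "t - n"] that by (simp add: r_def)
  next
    case False
    then show ?thesis using stable[of t t "n - t"] by (simp add: r_def len)
  qed
  have map_r: "map r [0..<Suc (length h) + n] = Hs n" for n
    by (rule nth_equalityI) (simp_all add: len r_nth del: upt_Suc)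
  have "r (Suc t) = map (stay (\<sigma> (map r [0..<Suc t]))) (r t)" if "length h \<le> t" for t
  proof -
    define n where "n = t - length h"
    have t: "t = length h + n" using that by (simp add: n_def)
    have m: "map r [0..<Suc t] = Hs n" using map_r[of n] by (simp add: t)
    have "r t = last (Hs n)" unfolding m[symmetric] by simp
    moreover have "r (Suc t) = last (Hs (Suc n))" unfolding map_r[of "Suc n", symmetric] by (simp add: t)
    ultimately show ?thesis by (simp add: m HsSuc del: upt_Suc)
  qed
  then show ?thesis using map_r[of 0] by (intro exI[of _ r]) (simp add: Hs_def)
qed

text \<open>The history \<open>h\<close> is arbitrary and all claims concern times from
  \<open>length h\<close> on, which lets the induction proceed forward in time: at a step,
  \<open>\<sigma>\<close> applied to the extended history selects the robbers' answer, and the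
  induction hypothesis is used for that longer history. With \<open>h = []\<close> a complete play
  results.\<close>

lemma wins_play:
  assumes "wins G k p x y D" "finite (verts G)" "cop_strategy G \<sigma>" "\<sigma> h = p"
  shows "\<exists>r. map r [0..<Suc (length h)] = h @ [[x, y]] \<and>
    (\<forall>t\<ge>length h. length (r t) = 2) \<and>
    (\<forall>t\<ge>length h. \<forall>i<2. robber_step G (\<sigma> (map r [0..<Suc t])) (r t ! i) (r (Suc t) ! i)) \<and>
    card (verts G - (D \<union> {v. \<exists>t\<ge>length h. \<exists>i<2. r t ! i = Some v \<and> r (Suc t) ! i \<noteq> None})) \<le> k"
  using assms(1,4)
proof (induction arbitrary: h)
  case (wins_done D p x y)
  obtain r where r: "map r [0..<Suc (length h)] = h @ [[x, y]]" 
      "\<And>t. t\<ge>length h \<Longrightarrow> r (Suc t) = map (stay (\<sigma> (map r [0..<Suc t]))) (r t)"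
    using stay_play[of h "[x, y]" \<sigma>] by blast
  have len: "length (r t) = 2" if "length h \<le> t" for t
    using that
  proof (induction t rule: dec_induct)
    case base
    have "r (length h) = [x, y]" using arg_cong[OF r(1), of last] by simp
    then show ?case by simp
  next
    case (step t)
    then show ?case using r(2)[of t] by simp
  qed
  have "robber_step G (\<sigma> (map r [0..<Suc t])) (r t ! i) (r (Suc t) ! i)" 
    if "length h \<le> t" "i < 2" for t i
    using that by (simp add: r(2) len robber_step_stay del: upt_Suc)
  moreover have "card (verts G - (D \<union> X)) \<le> k" for X
  proof -
    have "card (verts G - (D \<union> X)) \<le> card (verts G - D)"
      by (rule card_mono) (use assms(2) in auto)
    then show ?thesis using wins_done.hyps by simp
  qed
  ultimately show ?case using r(1) len by blast
next
  case (wins_step p x y D)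
  let ?h = "h @ [[x, y]]"
  have "may_move G p (\<sigma> ?h)" 
    using assms(3) wins_step.prems by (auto simp: cop_strategy_def)
  from wins_step.IH[OF this] obtain x' y' where st: 
    "robber_step G (\<sigma> ?h) x x'" "robber_step G (\<sigma> ?h) y y'" and
    IH: "\<And>h'. \<sigma> h' = \<sigma> ?h \<Longrightarrow> (\<exists>r. map r [0..<Suc (length h')] = h' @ [[x', y']] \<and>
    (\<forall>t\<ge>length h'. length (r t) = 2) \<and>
    (\<forall>t\<ge>length h'. \<forall>i<2. robber_step G (\<sigma> (map r [0..<Suc t])) (r t ! i) (r (Suc t) ! i)) \<and>
    card (verts G - (D \<union> hit x x' \<union> hit y y' \<union>
      {v. \<exists>t\<ge>length h'. \<exists>i<2. r t ! i = Some v \<and> r (Suc t) ! i \<noteq> None})) \<le> k)"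
    by blast
  obtain r where r: "map r [0..<Suc (Suc (length h))] = ?h @ [[x', y']]"
    "\<And>t. t \<ge> Suc (length h) \<Longrightarrow> length (r t) = 2"
    "\<And>t i. t \<ge> Suc (length h) \<Longrightarrow> i < 2 \<Longrightarrow> robber_step G (\<sigma> (map r [0..<Suc t])) (r t ! i) (r (Suc t) ! i)"
    "card (verts G - (D \<union> hit x x' \<union> hit y y' \<union>
      {v. \<exists>t\<ge>Suc (length h). \<exists>i<2. r t ! i = Some v \<and> r (Suc t) ! i \<noteq> None})) \<le> k"
    using IH[of ?h] by (auto simp del: upt_Suc)
  have h: "map r [0..<Suc (length h)] = ?h" and r1: "r (Suc (length h)) = [x', y']"
    using r(1) by (simp_all del: upt_Suc add: upt_Suc_append)
  have r0: "r (length h) = [x, y]" using arg_cong[OF h, of last] by simp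
  have "length (r t) = 2" if "length h \<le> t" for t
    using r(2)[of t] r0 that by (cases "t = length h") auto
  moreover have "robber_step G (\<sigma> (map r [0..<Suc t])) (r t ! i) (r (Suc t) ! i)"
    if "length h \<le> t" "i < 2" for t i
  proof (cases "t = length h")
    case True
    then show ?thesis using st r0 r1 that(2) by (cases i) (auto simp: h less_Suc_eq simp del: upt_Suc)
  next
    case False
    then show ?thesis using r(3) that by simp
  qed
  moreover have "card (verts G - (D \<union> {v. \<exists>t\<ge>length h. \<exists>i<2. r t ! i = Some v \<and> r (Suc t) ! i \<noteq> None})) \<le> k"
    (is "card (_ - (D \<union> ?X)) \<le> k")
  proof -
    have hit_iff: "v \<in> hit z z' \<longleftrightarrow> z = Some v \<and> z' \<noteq> None" for v :: 'a and z z'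
      by (auto simp: hit_def elem_set)
    have "hit x x' \<subseteq> ?X"
      unfolding hit_iff subset_iff mem_Collect_eq
      using r0 r1 by (intro allI impI exI[of _ "length h"] conjI exI[of _ "0::nat"]) auto
    moreover have "hit y y' \<subseteq> ?X"
      unfolding hit_iff subset_iff mem_Collect_eq
      using r0 r1 by (intro allI impI exI[of _ "length h"] conjI exI[of _ "1::nat"]) auto
    moreover have "{v. \<exists>t\<ge>Suc (length h). \<exists>i<2. r t ! i = Some v \<and> r (Suc t) ! i \<noteq> None} \<subseteq> ?X"
      using Suc_leD by blast
    ultimately have "card (verts G - (D \<union> ?X)) \<le> card (verts G - (D \<union> hit x x' \<union> hit y y' \<union>
      {v. \<exists>t\<ge>Suc (length h). \<exists>i<2. r t ! i = Some v \<and> r (Suc t) ! i \<noteq> None}))"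
      by (intro card_mono) (use assms(2) in auto)
    then show ?thesis using r(4) by simp
  qed
  ultimately show ?case using h by blast
qed

lemma dmg_ge_robbers_leave:
  assumes G: "simple_graph G" "verts G \<noteq> {}" and leave: "robbers_leave G k"
  shows "card (verts G) - k \<le> dmg G 2"
proof (rule dmg_ge[OF G])
  fix \<sigma> :: "'a strategy" assume \<sigma>: "cop_strategy G \<sigma>"
  then have "\<sigma> [] \<in> verts G" by (simp add: cop_strategy_def)
  then obtain x y where start: "robber_start G (\<sigma> []) x" "robber_start G (\<sigma> []) y" 
      and w: "wins G k (\<sigma> []) x y {}"
    using leave by (auto simp: robbers_leave_def)
  from wins_play[OF w finite_verts[OF G(1)] \<sigma> refl]
  obtain r where r: "map r [0..<Suc 0] = [[x, y]]" "\<And>t. length (r t) = 2"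
    "\<And>t i. i < 2 \<Longrightarrow> robber_step G (cop_pos \<sigma> r (Suc t)) (r t ! i) (r (Suc t) ! i)"
    "card (verts G - damaged 2 r) \<le> k"
    by (auto simp: cop_pos_def damaged_def simp del: upt_Suc)
  have "r 0 = [x, y]" using r(1) by simp
  then have "robber_play G 2 \<sigma> r"
    using r(2,3) start by (auto simp: robber_play_def cop_pos_def less_2_cases_iff)
  moreover from this have "damaged 2 r \<subseteq> verts G" by (rule damaged_subset_verts[OF G(1)])
  ultimately show "\<exists>r. robber_play G 2 \<sigma> r \<and> card (verts G) - k \<le> card (damaged 2 r)"
    using r(4) finite_verts[OF G(1)] by (intro exI[of _ r]) (simp add: card_Diff_subset finite_subset)
qed

section \<open>Transport along an isomorphism\<close>

context
  fixes G :: "'a ugraph" and H :: "'b ugraph" and f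
  assumes G: "simple_graph G" and H: "simple_graph H"
    and bij: "bij_betw f (verts H) (verts G)"
    and adj: "\<And>u v. u \<in> verts H \<Longrightarrow> v \<in> verts H \<Longrightarrow> adjacent G (f u) (f v) \<longleftrightarrow> adjacent H u v"
begin

lemma may_move_image:
  assumes "u \<in> verts H" "may_move H u v"
  shows "v \<in> verts H" "may_move G (f u) (f v)"
proof -
  have "adjacent H u v \<or> v = u" using assms(2) by (auto simp: may_move_def)
  then show v: "v \<in> verts H" using assms(1) adjacent_vertsD(2)[OF H, of u v] by blast
  then show "may_move G (f u) (f v)"
    using adj[OF assms(1) v] assms(2) by (auto simp: may_move_def)
qed

lemma may_move_imageE:
  assumes "u \<in> verts H" "may_move G (f u) q"
  obtains v where "v \<in> verts H" "q = f v" "may_move H u v"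
proof -
  have "q \<in> verts G"
    using assms bij adjacent_vertsD[OF G, of "f u" q] by (auto simp: may_move_def bij_betw_def)
  then obtain v where "v \<in> verts H" "q = f v" using bij by (auto simp: bij_betw_def)
  moreover from this have "may_move H u v"
    using assms adj bij by (auto simp: may_move_def bij_betw_def inj_on_def)
  ultimately show thesis by (rule that)
qed

lemma status_image:
  assumes "c \<in> verts H" "v \<in> verts H"
  shows "status (f c) (f v) = map_option f (status c v)" "set_option (status c v) \<subseteq> verts H"
proof -
  have "f v = f c \<longleftrightarrow> v = c"
    using assms bij by (meson bij_betw_def inj_on_eq_iff)
  then show "status (f c) (f v) = map_option f (status c v)" "set_option (status c v) \<subseteq> verts H"
    using assms by (auto simp: status_def)
qed

lemma robber_step_image:
  assumes "c \<in> verts H" "set_option x \<subseteq> verts H" "robber_step H c x x'"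
  shows "set_option x' \<subseteq> verts H" "robber_step G (f c) (map_option f x) (map_option f x')"
proof -
  have "set_option x' \<subseteq> verts H \<and> robber_step G (f c) (map_option f x) (map_option f x')"
  proof (cases x)
    case (Some u)
    then have u: "u \<in> verts H" using assms by simp
    show ?thesis
    proof (cases "u = c")
      case False
      then obtain v where v: "may_move H u v" "x' = status c v" using assms(3) Some by auto
      have "f u \<noteq> f c" using False u assms(1) bij by (auto simp: bij_betw_def inj_on_def)
      then show ?thesis
        using v status_image[OF assms(1)] may_move_image[OF u v(1)] Some by auto
    qed (use assms Some in auto)
  qed (use assms in auto)
  then show "set_option x' \<subseteq> verts H" "robber_step G (f c) (map_option f x) (map_option f x')"
    by simp_all
qed

text \<open>Every cop move in \<open>G\<close> from an image vertex lifts to \<open>H\<close>, and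
  the answer found there is mapped back. The damaged set is cut down to \<open>verts H\<close>
  because \<open>f\<close> is injective only there.\<close>

lemma wins_image:
  assumes "wins H k p x y D" "p \<in> verts H" "set_option x \<subseteq> verts H" "set_option y \<subseteq> verts H"
  shows "wins G k (f p) (map_option f x) (map_option f y) (f ` (D \<inter> verts H))"
  using assms
proof induction
  case (wins_done D p x y)
  have inj: "inj_on f (verts H)" and V: "verts G = f ` verts H" 
    using bij by (auto simp: bij_betw_def)
  have "verts G - f ` (D \<inter> verts H) = f ` (verts H - D)"
    unfolding V using inj by (auto simp: inj_on_def)
  moreover have "card (f ` (verts H - D)) = card (verts H - D)"
    by (intro card_image inj_on_subset[OF inj]) auto
  ultimately show ?case using wins_done.hyps by (intro wins.wins_done) simp
next
  case (wins_step p x y D)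
  show ?case
  proof (rule wins.wins_step)
    fix q assume "may_move G (f p) q"
    then obtain p' where p': "p' \<in> verts H" "q = f p'" "may_move H p p'"
      using may_move_imageE wins_step.prems(1) by blast
    from wins_step.IH[OF p'(3)] obtain x' y' where st: "robber_step H p' x x'" "robber_step H p' y y'"
      and IH: "p' \<in> verts H \<Longrightarrow> set_option x' \<subseteq> verts H \<Longrightarrow> set_option y' \<subseteq> verts H \<Longrightarrow>
        wins G k (f p') (map_option f x') (map_option f y') (f ` ((D \<union> hit x x' \<union> hit y y') \<inter> verts H))"
      by blast
    note ix = robber_step_image[OF p'(1) wins_step.prems(2) st(1)]
    note iy = robber_step_image[OF p'(1) wins_step.prems(3) st(2)]
    have hit: "f ` (hit z z' \<inter> verts H) = hit (map_option f z) (map_option f z')"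
      if "set_option z \<subseteq> verts H" for z z'
      using that by (auto simp: hit_def option.set_map)
    have "wins G k q (map_option f x') (map_option f y')
      (f ` (D \<inter> verts H) \<union> hit (map_option f x) (map_option f x') \<union> hit (map_option f y) (map_option f y'))"
      using IH[OF p'(1) ix(1) iy(1)] wins_step.prems(2,3)
      by (simp add: Int_Un_distrib2 image_Un hit p'(2))
    then show "\<exists>x' y'. robber_step G q (map_option f x) x' \<and> robber_step G q (map_option f y) y' \<and>
        wins G k q x' y' (f ` (D \<inter> verts H) \<union> hit (map_option f x) x' \<union> hit (map_option f y) y')"
      using ix(2) iy(2) p'(2) by blast
  qed
qed

lemma wins_start_image:
  assumes "c \<in> verts H" "\<exists>x y. robber_start H c x \<and> robber_start H c y \<and> wins H k c x y {}"
  shows "\<exists>x y. robber_start G (f c) x \<and> robber_start G (f c) y \<and> wins G k (f c) x y {}"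
proof -
  from assms(2) obtain x y u w where xy: "u \<in> verts H" "x = status c u" "w \<in> verts H" "y = status c w" 
      "wins H k c x y {}"
    by (auto simp: robber_start_def)
  then have "wins G k (f c) (map_option f x) (map_option f y) {}"
    using wins_image[of k c x y "{}"] assms(1) status_image(2) by simp
  moreover have "map_option f x = status (f c) (f u)" "map_option f y = status (f c) (f w)"
    using status_image(1)[OF assms(1)] xy by simp_all
  moreover have "f u \<in> verts G" "f w \<in> verts G" using bij xy by (auto simp: bij_betw_def)
  ultimately show ?thesis unfolding robber_start_def by blast
qed

lemma robbers_leave_image:
  assumes "robbers_leave H k"
  shows "robbers_leave G k"
  unfolding robbers_leave_def
proof
  fix q assume "q \<in> verts G"
  then obtain c where c: "c \<in> verts H" "q = f c" using bij by (auto simp: bij_betw_def)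
  then show "\<exists>x y. robber_start G q x \<and> robber_start G q y \<and> wins G k q x y {}"
    using wins_start_image[OF c(1)] assms unfolding robbers_leave_def c(2) by blast
qed

end

text \<open>The map goes from the model \<open>H\<close> to \<open>G\<close>, against the direction
  in \<open>isomorphic_def\<close>, since maps out of explicit number sets are easy to write
  down.\<close>

lemma isomorphicI:
  assumes "bij_betw f (verts H) (verts G)"
    and "\<And>u v. u \<in> verts H \<Longrightarrow> v \<in> verts H \<Longrightarrow> adjacent G (f u) (f v) \<longleftrightarrow> adjacent H u v"
  shows "G \<cong>\<^sub>g H"
proof -
  let ?g = "inv_into (verts H) f"
  have inv: "?g u \<in> verts H" "f (?g u) = u" if "u \<in> verts G" for u
    using assms(1) that by (auto simp: bij_betw_def inv_into_into f_inv_into_f)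
  have "adjacent G u v \<longleftrightarrow> adjacent H (?g u) (?g v)" if "u \<in> verts G" "v \<in> verts G" for u v
    using assms(2)[of "?g u" "?g v"] inv that by simp
  then show ?thesis
    using bij_betw_inv_into[OF assms(1)] unfolding isomorphic_def by blast
qed

lemma isomorphicE:
  assumes "G \<cong>\<^sub>g H"
  obtains f where "bij_betw f (verts H) (verts G)"
    "\<And>u v. u \<in> verts H \<Longrightarrow> v \<in> verts H \<Longrightarrow> adjacent G (f u) (f v) \<longleftrightarrow> adjacent H u v"
proof -
  obtain g where g: "bij_betw g (verts G) (verts H)"
    "\<And>u v. u \<in> verts G \<Longrightarrow> v \<in> verts G \<Longrightarrow> adjacent G u v \<longleftrightarrow> adjacent H (g u) (g v)"
    using assms by (auto simp: isomorphic_def)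
  let ?f = "inv_into (verts G) g"
  have inv: "?f u \<in> verts G" "g (?f u) = u" if "u \<in> verts H" for u
    using g(1) that by (auto simp: bij_betw_def inv_into_into f_inv_into_f)
  then show thesis using that[OF bij_betw_inv_into[OF g(1)]] g(2) by simp
qed

section \<open>Upper bounds on the damage number\<close>

text \<open>By \<open>guard_damage\<close>, \<open>v\<close> and \<open>u\<close> are always spared,
  degree 3 leaves 4 - 1 vertices and higher degree at least 5 - 2. For degree 2 a third vertex is
  needed only if \<open>S\<close> is nonempty; then both robbers live in \<open>C\<close>, so every
  vertex outside \<open>C\<close> is undamaged.\<close>

lemma undamaged_guard:
  assumes G: "simple_graph G" and v: "v \<in> verts G" and play: "robber_play G 2 (guard G v) r"
  shows "min 2 (Suc (card (nbrs G v))) \<le> card (verts G - damaged 2 r)" (is ?basic)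
    and "3 \<le> card (nbrs G v) \<Longrightarrow> 3 \<le> card (verts G - damaged 2 r)"
    and "\<lbrakk>card (nbrs G v) = 2; adj_closed G C; v \<in> C; w \<in> verts G; w \<notin> C\<rbrakk>
      \<Longrightarrow> 3 \<le> card (verts G - damaged 2 r)"
proof -
  let ?U = "verts G - damaged 2 r" and ?N = "nbrs G v"
  obtain u S where S: "damaged 2 r \<inter> insert v ?N \<subseteq> S" "S \<subseteq> ?N - {u}"
    "S \<noteq> {} \<longrightarrow> adjacent G v u" "card S \<le> 2" "card ?N = 3 \<longrightarrow> card S \<le> 1"
    "S \<noteq> {} \<longrightarrow> (\<forall>i<2. \<exists>t. \<exists>w\<in>?N. r t ! i = Some w)"
    using guard_damage[OF assms] by metis
  have fin: "finite ?U" "finite ?N" "finite S"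
    using finite_verts[OF G] finite_nbrs[OF G] S(2) finite_subset by fastforce+
  have NV: "insert v ?N \<subseteq> verts G" using v nbrs_subset_verts[OF G] by simp
  have sub: "insert v ?N - S \<subseteq> ?U" using NV S(1) by blast
  have card_NS: "card (insert v ?N - S) = Suc (card ?N) - card S"
    using S(2) fin by (subst card_Diff_subset) (auto simp: card_insert_nbrs[OF G])
  have le: "Suc (card ?N) - card S \<le> card ?U"
    using card_mono[OF fin(1) sub] card_NS by simp
  have less: "card S < card ?N" if "S \<noteq> {}"
  proof -
    have "u \<in> ?N" using S(3) that by simp
    then show ?thesis using S(2) fin by (intro psubset_card_mono) auto
  qed
  show ?basic using le less by (cases "S = {}") auto
  show "3 \<le> card ?U" if "3 \<le> card ?N"
    using le S(4,5) that by linarith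
  show "3 \<le> card ?U" if deg: "card ?N = 2" and C: "adj_closed G C" "v \<in> C" and w: "w \<in> verts G" "w \<notin> C"
  proof (cases "S = {}")
    case True
    then show ?thesis using le deg by simp
  next
    case False
    have NC: "insert v ?N \<subseteq> C" using C by (auto simp: adj_closed_def)
    \<comment> \<open>A robber starting outside \<open>C\<close> could never have visited a
      neighbour of \<open>v\<close>.\<close>
    have start_C: "u0 \<in> C" if "i < 2" "r 0 ! i = Some u0" for i u0
    proof (rule ccontr)
      assume "u0 \<notin> C"
      obtain t x where "x \<in> ?N" "r t ! i = Some x" using S(6) False \<open>i < 2\<close> by blast
      then have "x \<in> - C"
        using play_closed[OF G play that(1) adj_closed_Compl[OF C(1)] that(2)] \<open>u0 \<notin> C\<close> by blast
      then show False using NC \<open>x \<in> ?N\<close> by blast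
    qed
    have "w \<notin> damaged 2 r"
    proof
      assume "w \<in> damaged 2 r"
      then obtain t i where i: "i < 2" "r t ! i = Some w" by (auto simp: damaged_def)
      then obtain u0 where "r 0 ! i = Some u0" using play_start_Some[OF G play] by metis
      then show False using play_closed[OF G play i(1) C(1) _ _ i(2)] start_C i(1) w by blast
    qed
    then have "insert w (insert v ?N - S) \<subseteq> ?U" using sub w(1) by blast
    then have "card (insert w (insert v ?N - S)) \<le> card ?U" by (rule card_mono[OF fin(1)])
    moreover have "w \<notin> insert v ?N - S" using NC w by blast
    ultimately show ?thesis using card_NS less[OF False] deg fin by simp
  qed
qed

lemma dmg_le_guard:
  assumes G: "simple_graph G" and "v \<in> verts G"
    and "\<And>r. robber_play G 2 (guard G v) r \<Longrightarrow> d \<le> card (verts G - damaged 2 r)"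
  shows "dmg G 2 \<le> card (verts G) - d"
proof (rule dmg_le[OF cop_strategy_guard[OF assms(2)]])
  fix r assume r: "robber_play G 2 (guard G v) r"
  have "damaged 2 r \<subseteq> verts G" by (rule damaged_subset_verts[OF G r])
  then have "card (verts G - damaged 2 r) = card (verts G) - card (damaged 2 r)"
    "card (damaged 2 r) \<le> card (verts G)"
    using finite_verts[OF G] by (auto simp: card_Diff_subset finite_subset card_mono)
  then show "card (damaged 2 r) \<le> card (verts G) - d" using assms(3)[OF r] by simp
qed

lemma card_nbrs_pos: "simple_graph G \<Longrightarrow> adjacent G v u \<Longrightarrow> 0 < card (nbrs G v)"
  using finite_nbrs by (fastforce simp: card_gt_0_iff)

lemma dmg_le_edge:
  assumes "simple_graph G" "adjacent G v u"
  shows "dmg G 2 \<le> card (verts G) - 2"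
proof (rule dmg_le_guard[OF assms(1)])
  show v: "v \<in> verts G" using adjacent_vertsD assms by metis
  show "2 \<le> card (verts G - damaged 2 r)" if "robber_play G 2 (guard G v) r" for r
    using undamaged_guard(1)[OF assms(1) v that] card_nbrs_pos[OF assms] by simp
qed

lemma dmg_le_degree_3:
  assumes "simple_graph G" "v \<in> verts G" "3 \<le> card (nbrs G v)"
  shows "dmg G 2 \<le> card (verts G) - 3"
  by (rule dmg_le_guard[OF assms(1,2)]) (rule undamaged_guard(2)[OF assms(1,2) _ assms(3)])

lemma dmg_le_disconnected:
  assumes "simple_graph G" "v \<in> verts G" "card (nbrs G v) = 2"
    and "adj_closed G C" "v \<in> C" "w \<in> verts G" "w \<notin> C"
  shows "dmg G 2 \<le> card (verts G) - 3"
  by (rule dmg_le_guard[OF assms(1,2)]) (rule undamaged_guard(3)[OF assms(1,2) _ assms(3-)])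

lemma nbrs_eq_singleton:
  assumes "simple_graph G" "card (nbrs G v) \<le> 1" "adjacent G v b"
  shows "nbrs G v = {b}"
  using card_seteq[OF finite_nbrs[OF assms(1)], of "{b}" v] assms(2,3) by simp

text \<open>In maximum degree 1 the closed neighbourhoods are the connected components.\<close>

lemma adj_closed_nbrs:
  assumes G: "simple_graph G" and deg: "\<And>x. x \<in> verts G \<Longrightarrow> card (nbrs G x) \<le> 1"
  shows "adj_closed G (insert x (nbrs G x))"
  unfolding adj_closed_def
proof
  fix y assume "y \<in> insert x (nbrs G x)"
  then consider "y = x" | "adjacent G x y" by auto
  then show "nbrs G y \<subseteq> insert x (nbrs G x)"
  proof cases
    case 2
    then have "nbrs G y = {x}"
      using deg adjacent_vertsD(2)[OF G 2] by (intro nbrs_eq_singleton[OF G]) (simp_all add: adjacent_sym)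
    then show ?thesis by simp
  qed blast
qed

text \<open>Each robber is confined to the component it starts in, whatever the cop does.\<close>

lemma damaged_subset_starts:
  assumes G: "simple_graph G" and v: "v \<in> verts G" and play: "robber_play G 2 \<sigma> r"
    and deg: "\<And>x. x \<in> verts G \<Longrightarrow> card (nbrs G x) \<le> 1"
  obtains p q where "p \<in> verts G" "q \<in> verts G"
    "damaged 2 r \<subseteq> insert p (nbrs G p) \<union> insert q (nbrs G q)"
proof -
  have "\<exists>p\<in>verts G. \<forall>t w. r t ! i = Some w \<longrightarrow> w \<in> insert p (nbrs G p)" if i: "i < 2" for i
  proof (cases "r 0 ! i")
    case None
    \<comment> \<open>A robber captured at the start damages nothing, so any vertex serves as
      witness.\<close>
    then have "r t ! i = None" for t using play_None_mono[OF G play i, of 0 t] by simp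
    then show ?thesis using v by auto
  next
    case (Some p)
    then have p: "p \<in> verts G" using play_verts[OF G play i] by blast
    have "w \<in> insert p (nbrs G p)" if "r t ! i = Some w" for t w
      using play_closed[OF G play i adj_closed_nbrs[OF G deg] Some _ that] by blast
    with p show ?thesis by blast
  qed
  from this[of 0] this[of 1] obtain p q where pq: "p \<in> verts G" "q \<in> verts G"
    "\<forall>t w. r t ! 0 = Some w \<longrightarrow> w \<in> insert p (nbrs G p)"
    "\<forall>t w. r t ! 1 = Some w \<longrightarrow> w \<in> insert q (nbrs G q)" by auto
  have "damaged 2 r \<subseteq> insert p (nbrs G p) \<union> insert q (nbrs G q)"
  proof
    fix w assume "w \<in> damaged 2 r"
    then obtain t i where "i < 2" "r t ! i = Some w" by (auto simp: damaged_def)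
    then show "w \<in> insert p (nbrs G p) \<union> insert q (nbrs G q)"
      using pq(3,4) by (auto simp: less_2_cases_iff)
  qed
  with pq(1,2) show thesis by (rule that)
qed

lemma dmg_le_edgeless:
  assumes G: "simple_graph G" "verts G \<noteq> {}" and "\<And>u v. \<not> adjacent G u v"
  shows "dmg G 2 \<le> 2"
proof -
  obtain v where v: "v \<in> verts G" using G(2) by blast
  have nb: "nbrs G x = {}" for x using assms(3) by auto
  show ?thesis
  proof (rule dmg_le[OF cop_strategy_guard[OF v]])
    fix r assume r: "robber_play G 2 (guard G v) r"
    have deg: "card (nbrs G x) \<le> 1" for x by (simp add: nb)
    obtain p q where "damaged 2 r \<subseteq> insert p (nbrs G p) \<union> insert q (nbrs G q)"
      by (rule damaged_subset_starts[OF G(1) v r deg])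
    then have "damaged 2 r \<subseteq> {p, q}" by (auto simp: nb)
    then have "card (damaged 2 r) \<le> card {p, q}" by (rule card_mono[rotated]) simp
    also have "\<dots> \<le> 2" by (simp add: card_insert_if)
    finally show "card (damaged 2 r) \<le> 2" .
  qed
qed

text \<open>Guarding \<open>v\<close> keeps the edge \<open>{v, b}\<close> undamaged: a nonempty
  \<open>S\<close> would lie in \<open>{b} - {u}\<close> with \<open>u = b\<close>. A play leaving
  fewer than three vertices therefore damages everything else, and each robber damages only within
  its own component.\<close>

lemma verts_cover_if_dmg_gt:
  assumes G: "simple_graph G" and deg: "\<And>x. x \<in> verts G \<Longrightarrow> card (nbrs G x) \<le> 1"
    and vb: "adjacent G v b" and gt: "card (verts G) - 3 < dmg G 2"
  obtains p q where "p \<in> verts G" "q \<in> verts G"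
    "verts G = {v, b} \<union> insert p (nbrs G p) \<union> insert q (nbrs G q)"
proof -
  have v: "v \<in> verts G" "b \<in> verts G" "v \<noteq> b" using adjacent_vertsD[OF G vb] by auto
  have "\<exists>r. robber_play G 2 (guard G v) r \<and> card (verts G - damaged 2 r) < 3"
    using dmg_le_guard[OF G v(1), of 3] gt by (meson not_le)
  then obtain r where r: "robber_play G 2 (guard G v) r" "card (verts G - damaged 2 r) < 3" by blast
  obtain u S where S: "damaged 2 r \<inter> insert v (nbrs G v) \<subseteq> S" "S \<subseteq> nbrs G v - {u}" 
      "S \<noteq> {} \<longrightarrow> adjacent G v u"
    using guard_damage[OF G v(1) r(1)] by metis
  have nb: "nbrs G v = {b}"
    by (rule nbrs_eq_singleton[OF G deg[OF v(1)] vb])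
  have "S = {}"
  proof (rule ccontr)
    assume "S \<noteq> {}"
    moreover from this have "u \<in> nbrs G v" using S(3) by simp
    ultimately show False using S(2) unfolding nb by auto
  qed
  then have "damaged 2 r \<inter> {v, b} = {}" using S(1) nb by simp
  then have sub: "{v, b} \<subseteq> verts G - damaged 2 r" using v by blast
  have "{v, b} = verts G - damaged 2 r"
    by (rule card_seteq[OF _ sub]) (use finite_verts[OF G] r(2) v in auto)
  moreover obtain p q where pq: "p \<in> verts G" "q \<in> verts G"
    "damaged 2 r \<subseteq> insert p (nbrs G p) \<union> insert q (nbrs G q)"
    using damaged_subset_starts[OF G v(1) r(1) deg] by blast
  ultimately have "verts G \<subseteq> {v, b} \<union> insert p (nbrs G p) \<union> insert q (nbrs G q)" by blast
  moreover have "{v, b} \<union> insert p (nbrs G p) \<union> insert q (nbrs G q) \<subseteq> verts G"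
    using v pq nbrs_subset_verts[OF G] by blast
  ultimately show thesis using that[OF pq(1,2)] by blast
qed

section \<open>Paths\<close>

lemma wins_doneI:
  assumes "verts G \<subseteq> D \<union> {a, b}"
  shows "wins G 2 p x y D"
proof (rule wins_done)
  have "card (verts G - D) \<le> card {a, b}" by (rule card_mono) (use assms in auto)
  also have "\<dots> \<le> 2" by (simp add: card_insert_if)
  finally show "card (verts G - D) \<le> 2" .
qed

lemma robber_moveI: "\<lbrakk>u \<noteq> c; w \<noteq> c; may_move G u w\<rbrakk> \<Longrightarrow> robber_step G c (Some u) (Some w)"
  by (auto simp: status_def)

lemma may_move_refl [simp]: "may_move G u u"
  by (simp add: may_move_def)

lemma verts_path [simp]: "verts (path_graph m) = {..<m}"
  by (simp add: path_graph_def)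

lemma adjacent_path: "adjacent (path_graph m) i j \<longleftrightarrow> (j = Suc i \<and> j < m) \<or> (i = Suc j \<and> i < m)"
  by (auto simp: adjacent_def path_graph_def doubleton_eq_iff)

lemma simple_path: "simple_graph (path_graph m)"
  by (auto simp: simple_graph_def path_graph_def)

lemma may_move_path:
  "may_move (path_graph m) p q \<longleftrightarrow> q = p \<or> (q = Suc p \<and> q < m) \<or> (p = Suc q \<and> p < m)"
  by (auto simp: may_move_def adjacent_path)

text \<open>The cop is at least two behind and never catches up, so the robber sweeps everything to
  its right; \<open>a\<close> and \<open>b\<close> are the two vertices given up for good.\<close>

lemma wins_run_right:
  assumes "z < m" "p + 2 \<le> z" "\<And>v. v < z \<Longrightarrow> v \<in> D \<or> v = a \<or> v = b"
  shows "wins (path_graph m) 2 p x (Some z) D"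
  using assms
proof (induction "m - z" arbitrary: z p x D rule: less_induct)
  case less
  show ?case
  proof (rule wins_step)
    fix p' assume p': "may_move (path_graph m) p p'"
    \<comment> \<open>At the right end the robber just waits: surviving one more round damages
      \<open>m - 1\<close>.\<close>
    define z' where "z' = (if Suc z < m then Suc z else z)"
    let ?x = "stay p' x" and ?D = "D \<union> hit x (stay p' x) \<union> {z}"
    have le: "p' + 1 \<le> z" using p' less.prems(2) by (auto simp: may_move_path)
    then have "robber_step (path_graph m) p' (Some z) (Some z')"
      by (intro robber_moveI) (auto simp: z'_def may_move_path)
    moreover have "wins (path_graph m) 2 p' ?x (Some z') ?D"
    proof (cases "Suc z < m")
      case True
      then show ?thesis using less.prems le by (intro less.hyps) (auto simp: z'_def less_Suc_eq)
    next
      case False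
      then have "v \<in> ?D \<union> {a, b}" if "v < m" for v
        using less.prems(3)[of v] that by (cases "v = z") auto
      then show ?thesis by (intro wins_doneI[of _ _ a b]) auto
    qed
    ultimately show "\<exists>x' y'. robber_step (path_graph m) p' x x' \<and> robber_step (path_graph m) p' (Some z) y' \<and>
        wins (path_graph m) 2 p' x' y' (D \<union> hit x x' \<union> hit (Some z) y')"
      using robber_step_stay by (intro exI[of _ ?x] exI[of _ "Some z'"]) simp
  qed
qed

text \<open>After the right robber has been captured at the far end, the left robber at \<open>l\<close> reaches
  \<open>a - 1\<close> before the cop can be back.\<close>

lemma wins_race:
  assumes "l < a" "2 * a \<le> p + l" "p < m" "\<And>v. v < m \<Longrightarrow> v < l \<or> a + 2 \<le> v \<Longrightarrow> v \<in> D"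
  shows "wins (path_graph m) 2 p (Some l) None D"
  using assms
proof (induction "a - l" arbitrary: l p D rule: less_induct)
  case less
  show ?case
  proof (rule wins_step)
    fix p' assume p': "may_move (path_graph m) p p'"
    let ?D = "D \<union> {l}"
    \<comment> \<open>A round lowers \<open>p\<close> by at most 1 and raises \<open>l\<close> by 1,
      so \<open>2 * a <= p + l\<close> persists. When L is on \<open>a - 1\<close>, it still puts
      the cop beyond \<open>a\<close>, and L can safely wait a round.\<close>
    have le: "p \<le> p' + 1" "p' < m" using p' less.prems(3) by (auto simp: may_move_path)
    have "\<exists>l'. robber_step (path_graph m) p' (Some l) (Some l') \<and>
        wins (path_graph m) 2 p' (Some l') None ?D"
    proof (cases "Suc l = a")
      case True
      then have "v \<in> ?D \<union> {a, Suc a}" if "v < m" for v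
        using less.prems(4)[OF that] by (cases "v < l \<or> a + 2 \<le> v") auto
      then have "wins (path_graph m) 2 p' (Some l) None ?D"
        by (intro wins_doneI[of _ _ a "Suc a"]) auto
      moreover have "robber_step (path_graph m) p' (Some l) (Some l)"
        by (intro robber_moveI) (use less.prems le True in auto)
      ultimately show ?thesis by blast
    next
      case False
      have "robber_step (path_graph m) p' (Some l) (Some (Suc l))"
        by (intro robber_moveI) (use less.prems le False in \<open>auto simp: may_move_path\<close>)
      moreover have "wins (path_graph m) 2 p' (Some (Suc l)) None ?D"
        by (rule less.hyps) (use less.prems le False in \<open>auto simp: less_Suc_eq\<close>)
      ultimately show ?thesis by blast
    qed
    then show "\<exists>x' y'. robber_step (path_graph m) p' (Some l) x' \<and> robber_step (path_graph m) p' None y' \<and>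
        wins (path_graph m) 2 p' x' y' (D \<union> hit (Some l) x' \<union> hit None y')"
      by force
  qed
qed

text \<open>L has stepped next to the cop, R is two ahead of her or at the end. If she captures L,
  she moves away from R, who comes back to \<open>p + 1\<close> and gives up only
  \<open>p - 1\<close> and \<open>p\<close>. Otherwise L damages \<open>p - 1\<close>, and
  \<open>p\<close>, \<open>p + 1\<close> may stay undamaged.\<close>

lemma wins_entered:
  assumes "1 \<le> p" "p + 2 \<le> m" "\<And>v. v + 1 < p \<Longrightarrow> v \<in> D"
  shows "wins (path_graph m) 2 p (Some (p - 1)) (Some (min (p + 2) (m - 1))) D"
proof (rule wins_step)
  let ?G = "path_graph m" and ?r = "min (p + 2) (m - 1)"
  fix q assume "may_move ?G p q"
  then consider "q = p - 1" | "q = p" | "q = p + 1" "q < m" by (auto simp: may_move_path)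
  then show "\<exists>x' y'. robber_step ?G q (Some (p - 1)) x' \<and> robber_step ?G q (Some ?r) y' \<and>
      wins ?G 2 q x' y' (D \<union> hit (Some (p - 1)) x' \<union> hit (Some ?r) y')"
  proof cases
    case 1
    have "robber_step ?G q (Some ?r) (Some (p + 1))"
      by (intro robber_moveI) (use 1 assms in \<open>auto simp: may_move_path min_def\<close>)
    moreover have "wins ?G 2 q None (Some (p + 1)) (D \<union> {?r})"
    proof (rule wins_run_right[of _ _ _ _ "p - 1" p])
      show "v \<in> D \<union> {?r} \<or> v = p - 1 \<or> v = p" if "v < p + 1" for v
        using assms(3)[of v] that by (cases "v + 1 < p") auto
    qed (use 1 assms in auto)
    ultimately show ?thesis using 1 by (intro exI[of _ None] exI[of _ "Some (p + 1)"]) simp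
  next
    case 2
    have "robber_step ?G q (Some (p - 1)) (Some (p - 1))" "robber_step ?G q (Some ?r) (Some ?r)"
      by (intro robber_moveI; use 2 assms in auto)+
    moreover have "wins ?G 2 q (Some (p - 1)) (Some ?r) (D \<union> {p - 1} \<union> {?r})"
    proof (cases "p + 2 < m")
      case True
      have "v \<in> D \<union> {p - 1} \<union> {?r} \<or> v = p \<or> v = p + 1" if "v < p + 2" for v
        using assms(3)[of v] that by (cases "v + 1 < p") auto
      then show ?thesis using True 2 by (intro wins_run_right[of _ _ _ _ p "p + 1"]) auto
    next
      case False
      have "v \<in> D \<union> {p - 1} \<union> {?r} \<union> {p, p}" if "v < m" for v
        using assms(2) assms(3)[of v] that False by (cases "v + 1 < p") auto
      then show ?thesis by (intro wins_doneI[of _ _ p p]) auto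
    qed
    ultimately show ?thesis by (intro exI[of _ "Some (p - 1)"] exI[of _ "Some ?r"]) simp
  next
    case 3
    have L: "robber_step ?G q (Some (p - 1)) (Some (p - 1))"
      by (intro robber_moveI; use 3 assms in auto)
    have low: "v \<in> D \<union> {p - 1} \<or> v = p \<or> v = p + 1" if "v < p + 2" for v
      using assms(3)[of v] that by (cases "v + 1 < p") auto
    show ?thesis
    proof (cases "p + 3 < m")
      case True
      have "robber_step ?G q (Some ?r) (Some (p + 3))"
        by (intro robber_moveI) (use 3 True in \<open>auto simp: may_move_path\<close>)
      moreover have "wins ?G 2 q (Some (p - 1)) (Some (p + 3)) (D \<union> {p - 1} \<union> {?r})"
      proof (rule wins_run_right[of _ _ _ _ p "p + 1"])
        show "v \<in> D \<union> {p - 1} \<union> {?r} \<or> v = p \<or> v = p + 1" if "v < p + 3" for v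
          using low[of v] that True by (cases "v < p + 2") auto
      qed (use True 3 in auto)
      ultimately show ?thesis using L by (intro exI[of _ "Some (p - 1)"] exI[of _ "Some (p + 3)"]) simp
    next
      case False
      \<comment> \<open>If the path ends at \<open>p + 1\<close>, R is captured there, but that
        vertex is one of the two that may be lost. If it ends at \<open>p + 2\<close>, R survives by
        waiting.\<close>
      let ?y = "stay q (Some ?r)"
      have "wins ?G 2 q (Some (p - 1)) ?y (D \<union> {p - 1} \<union> hit (Some ?r) ?y)"
      proof (rule wins_doneI[of _ _ p "p + 1"], rule subsetI)
        fix v assume "v \<in> verts ?G"
        then have v: "v < m" by simp
        show "v \<in> D \<union> {p - 1} \<union> hit (Some ?r) ?y \<union> {p, p + 1}"
        proof (cases "v < p + 2")
          case True
          then show ?thesis using low by blast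
        next
          case False
          then have "v = p + 2" "m = p + 3" using v \<open>\<not> p + 3 < m\<close> by auto
          then show ?thesis using 3 by (auto simp: stay_def status_def)
        qed
      qed
      then have w: "wins ?G 2 q (Some (p - 1)) ?y (D \<union> hit (Some (p - 1)) (Some (p - 1)) \<union> hit (Some ?r) ?y)"
        unfolding hit_simps .
      show ?thesis by (rule exI, rule exI, rule conjI[OF L conjI[OF robber_step_stay w]])
    qed
  qed
qed

text \<open>Here \<open>a\<close> is the leftmost position the cop has taken so far. The assumption \<open>2 * a + 1 \<le> m\<close> makes
  chasing the right robber to the end \<open>m - 1\<close> too slow.\<close>

lemma wins_follow:
  assumes "l + 2 \<le> p" "p + 2 \<le> m" "a \<le> p" "2 * a + 1 \<le> m"
    "\<And>v. v < l \<Longrightarrow> v \<in> D" "\<And>v. v < m \<Longrightarrow> a + 2 \<le> v \<Longrightarrow> v \<le> p + 1 \<Longrightarrow> v \<in> D"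
  shows "wins (path_graph m) 2 p (Some l) (Some (min (p + 2) (m - 1))) D"
  using assms
\<comment> \<open>The cop can raise \<open>p\<close> by 1 per round and \<open>a\<close> never
  grows, so an advance of L, weighted by 2, pays for any cop move. When L waits and the chase goes
  on, the cop has moved left.\<close>
proof (induction "p + a + 2 * (m - l)" arbitrary: l p a D rule: less_induct)
  case less
  let ?G = "path_graph m" and ?r = "min (p + 2) (m - 1)"
  show ?case
  proof (rule wins_step)
    fix q assume "may_move ?G p q"
    then have q: "q = p \<or> q = p + 1 \<and> q < m \<or> q + 1 = p" by (auto simp: may_move_path)
    have low: "v \<in> D \<union> {l}" if "v \<le> l" for v using less.prems(5)[of v] that by (cases "v = l") auto
    show "\<exists>x' y'. robber_step ?G q (Some l) x' \<and> robber_step ?G q (Some ?r) y' \<and>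
        wins ?G 2 q x' y' (D \<union> hit (Some l) x' \<union> hit (Some ?r) y')"
    proof (cases "q + 1 = m")
      case True
      then have pm: "q = p + 1" "p + 2 = m" using q less.prems(2) by auto
      have "robber_step ?G q (Some l) (Some l)"
        by (intro robber_moveI) (use pm less.prems in auto)
      \<comment> \<open>R is lost at the end. Since \<open>q = m - 1\<close>, the bound
        \<open>2 * a + 1 <= m\<close> yields \<open>2 * a <= q + l\<close>, as
        \<open>wins_race\<close> requires. If L has already reached \<open>a\<close>, nothing
        outside \<open>{a, a + 1}\<close> is left.\<close>
      moreover have "wins ?G 2 q (Some l) None (D \<union> {l})"
      proof (cases "l < a")
        case True
        then show ?thesis
          by (rule wins_race) (use pm less.prems low in auto)
      next
        case False
        show ?thesis
        proof (rule wins_doneI[of _ _ a "a + 1"], rule subsetI)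
          fix v assume "v \<in> verts ?G"
          then show "v \<in> D \<union> {l} \<union> {a, a + 1}"
            using less.prems(6)[of v] low[of v] pm False by (cases "v \<le> l"; cases "a + 2 \<le> v") auto
        qed
      qed
      moreover have "robber_step ?G q (Some ?r) None" by (simp add: pm(1) pm(2)[symmetric])
      ultimately show ?thesis by (intro exI[of _ "Some l"] exI[of _ None]) simp
    next
      case False
      then have qm: "q + 2 \<le> m" using q less.prems(2) by auto
      let ?r' = "min (q + 2) (m - 1)" and ?D = "D \<union> {l} \<union> {?r}"
      have R: "robber_step ?G q (Some ?r) (Some ?r')"
        by (intro robber_moveI) (use q qm less.prems(2) in \<open>auto simp: may_move_path min_def\<close>)
      have high: "v \<in> ?D" if "v < m" "a + 2 \<le> v" "v \<le> p + 2" for v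
        using less.prems(6)[of v] that by (cases "v = p + 2") auto
      have high': "v \<in> ?D" if "v < m" "min a q + 2 \<le> v" "v \<le> q + 1" for v
      proof (rule high)
        show "a + 2 \<le> v" using that q less.prems(3) by (cases "a \<le> q") auto
        show "v \<le> p + 2" using that q by auto
      qed (rule that)
      have stay: ?thesis if "l \<noteq> q" "wins ?G 2 q (Some l) (Some ?r') ?D"
      proof -
        have "robber_step ?G q (Some l) (Some l)" using that by (intro robber_moveI) auto
        then show ?thesis using R that by (intro exI[of _ "Some l"] exI[of _ "Some ?r'"]) simp
      qed
      have advance: ?thesis if "l + 1 < q \<or> l + 1 < p \<and> q = p" "l + 1 \<noteq> q" "wins ?G 2 q (Some (l + 1)) (Some ?r') ?D"
      proof -
        have "robber_step ?G q (Some l) (Some (l + 1))"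
          by (intro robber_moveI) (use that qm in \<open>auto simp: may_move_path\<close>)
        then show ?thesis using R that by (intro exI[of _ "Some (l + 1)"] exI[of _ "Some ?r'"]) simp
      qed
      \<comment> \<open>L advances while the distance stays at least 2 (1) and waits when the cop
        approaches to distance 2 (4). In the other cases the sweep is over: R has already covered
        \<open>p + 1\<close> because \<open>a < p\<close> (2), L must enter (3), or the cop comes
        next to L and lets R run right behind her (5).\<close>
      consider "l + 3 \<le> q" | "q = p" "l + 2 = p" "a < p" | "q = p" "l + 2 = p" "a = p" 
        | "q + 1 = p" "l + 3 = p" | "q + 1 = p" "l + 2 = p"
        using q less.prems(1,3) by linarith
      then show ?thesis
      proof cases
        case 1
        have "wins ?G 2 q (Some (l + 1)) (Some ?r') ?D"
        proof (rule less.hyps[where a = "min a q"])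
          show "v \<in> ?D" if "v < l + 1" for v using low[of v] that by auto
        qed (use 1 q qm less.prems(1-4) high' in auto)
        then show ?thesis using 1 by (intro advance) auto
      next
        case 2
        have und: "v \<in> ?D \<or> v = p - 1 \<or> v = p" if "v < m" "v \<le> p + 2" for v
          using low[of v] high[of v] that 2 by (cases "v \<le> l"; cases "a + 2 \<le> v") auto
        have "wins ?G 2 q (Some l) (Some ?r') ?D"
        proof (cases "p + 2 < m")
          case True
          show ?thesis
          proof (rule wins_run_right[of _ _ _ _ "p - 1" p])
            show "v \<in> ?D \<or> v = p - 1 \<or> v = p" if "v < ?r'" for v
              by (rule und) (use that 2 in auto)
          qed (use True 2 in auto)
        next
          case False
          then have "v \<in> ?D \<union> {p - 1, p}" if "v < m" for v using und[of v] that by auto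
          then show ?thesis by (intro wins_doneI[of _ _ "p - 1" p] subsetI) simp
        qed
        then show ?thesis using 2 by (intro stay) auto
      next
        case 3
        have "wins ?G 2 p (Some (p - 1)) (Some (min (p + 2) (m - 1))) ?D"
          by (rule wins_entered) (use 3 qm low in auto)
        then have "wins ?G 2 q (Some (l + 1)) (Some ?r') ?D"
          using 3 by (metis add_diff_cancel_right' one_add_one add.assoc)
        then show ?thesis using 3 by (intro advance) auto
      next
        case 4
        have "wins ?G 2 q (Some l) (Some ?r') ?D"
        proof (rule less.hyps[where a = "min a q"])
          show "v \<in> ?D" if "v < l" for v using low[of v] that by auto
        qed (use 4 q qm less.prems(1-4) high' in auto)
        then show ?thesis using 4 by (intro stay) auto
      next
        case 5
        have "wins ?G 2 q (Some l) (Some ?r') ?D"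
        proof (rule wins_run_right[of _ _ _ _ q "q + 1"])
          show "v \<in> ?D \<or> v = q \<or> v = q + 1" if "v < ?r'" for v
            using low[of v] that 5 by (cases "v \<le> l") auto
        qed (use 5 less.prems(2) in auto)
        then show ?thesis using 5 by (intro stay) auto
      qed
    qed
  qed
qed

lemma robbers_leave_path:
  assumes "2 \<le> m"
  shows "robbers_leave (path_graph m) 2"
proof (cases "m = 2")
  case True
  then show ?thesis
    by (fastforce simp: robbers_leave_def robber_start_def intro: wins_done)
next
  case False
  let ?G = "path_graph m"
  let ?Q = "\<lambda>c. \<exists>x y. robber_start ?G c x \<and> robber_start ?G c y \<and> wins ?G 2 c x y {}"
  have startI: "?Q c" if "wins ?G 2 c (Some u) (Some w) {}" "u \<noteq> c" "w \<noteq> c" "u < m" "w < m" for c u w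
    using that unfolding robber_start_def status_def by (intro exI[of _ "Some u"] exI[of _ "Some w"]) auto
  \<comment> \<open>The start \<open>c\<close> is itself the leftmost cop position so far, hence
    \<open>a = c\<close>. For \<open>c = 0\<close> there is nothing to sweep on the left, and for
    \<open>c = 1\<close> L starts next to the cop.\<close>
  have half: "?Q c" if c: "2 * c + 1 \<le> m" for c
  proof -
    have m: "3 \<le> m" using assms False by simp
    consider "c = 0" | "c = 1" | "2 \<le> c" by linarith
    then show ?thesis
    proof cases
      case 1
      have "wins ?G 2 c (Some 2) (Some 2) {}"
        by (rule wins_run_right[of _ _ _ _ 0 1]) (use 1 m in auto)
      then show ?thesis by (rule startI) (use 1 m in auto)
    next
      case 2
      have "wins ?G 2 1 (Some (1 - 1)) (Some (min (1 + 2) (m - 1))) {}"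
        by (rule wins_entered) (use m in auto)
      then show ?thesis unfolding 2 by (rule startI) (use m in auto)
    next
      case 3
      have "wins ?G 2 c (Some 0) (Some (min (c + 2) (m - 1))) {}"
        by (rule wins_follow[where a = c]) (use 3 c in auto)
      then show ?thesis by (rule startI) (use 3 c in auto)
    qed
  qed
  have "?Q c" if "c < m" for c
  proof (cases "2 * c + 1 \<le> m")
    case True
    then show ?thesis by (rule half)
  next
    case nhalf: False
    \<comment> \<open>Reflecting the path brings a cop from the right half into the left
      half.\<close>
    let ?f = "\<lambda>i. m - 1 - i"
    have bij: "bij_betw ?f {..<m} {..<m}"
      by (rule bij_betw_byWitness[of _ ?f]) auto
    have "?Q (?f (?f c))"
    proof (rule wins_start_image[where f = ?f and c = "?f c", OF simple_path simple_path])
      show "bij_betw ?f (verts ?G) (verts ?G)" using bij by simp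
      show "adjacent ?G (?f u) (?f v) = adjacent ?G u v" if "u \<in> verts ?G" "v \<in> verts ?G" for u v
        using that by (auto simp: adjacent_path)
      show "?Q (?f c)" using nhalf that by (intro half) auto
    qed (use that in auto)
    then show ?thesis using that by simp
  qed
  then show ?thesis by (simp add: robbers_leave_def)
qed

section \<open>Cycles\<close>

lemma verts_cycle [simp]: "verts (cycle_graph m) = {..<m}"
  by (simp add: cycle_graph_def)

lemma adjacent_cycle:
  "adjacent (cycle_graph m) u v \<longleftrightarrow> (u < m \<and> v = Suc u mod m) \<or> (v < m \<and> u = Suc v mod m)"
  by (auto simp: adjacent_def cycle_graph_def doubleton_eq_iff)

lemma simple_cycle:
  assumes "2 \<le> m"
  shows "simple_graph (cycle_graph m)"
proof -
  have "Suc i mod m \<noteq> i" if "i < m" for i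
    using assms that by (cases "Suc i = m") auto
  then show ?thesis using assms by (fastforce simp: simple_graph_def cycle_graph_def card_insert_if)
qed

text \<open>The covering map from the integers; intervals of lifts replace arcs and their
  wrap-around.\<close>

definition cycle_vertex :: "nat \<Rightarrow> int \<Rightarrow> nat" where
  "cycle_vertex m i = nat (i mod int m)"

context
  fixes m :: nat
  assumes m: "3 \<le> m"
begin

private abbreviation (input) "C \<equiv> cycle_graph m"
private abbreviation (input) "g \<equiv> cycle_vertex m"

lemma cycle_vertex_less: "g i < m"
  using m by (simp add: cycle_vertex_def nat_less_iff)

lemma cycle_vertex_of_nat: "u < m \<Longrightarrow> g (int u) = u"
  by (simp add: cycle_vertex_def)

lemma cycle_vertex_eq_iff: "g i = g j \<longleftrightarrow> int m dvd i - j"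
  using m by (auto simp: cycle_vertex_def mod_eq_dvd_iff[symmetric] nat_eq_iff2)

lemma cycle_vertex_neq: 
  assumes "i < j" "j < i + int m"
  shows "g i \<noteq> g j" "g j \<noteq> g i"
  using assms zdvd_imp_le[of "int m" "j - i"] cycle_vertex_eq_iff[of j i] by auto

lemma cycle_vertex_shift: "g (i + int m) = g i"
  by (simp add: cycle_vertex_eq_iff)

lemma Suc_cycle_vertex: "Suc (g i) mod m = g (i + 1)"
proof -
  have "int (Suc (g i) mod m) = (i mod int m + 1) mod int m"
    using m by (simp add: cycle_vertex_def zmod_int add.commute)
  also have "\<dots> = int (g (i + 1))" using m by (simp add: cycle_vertex_def mod_add_left_eq)
  finally show ?thesis by simp
qed

lemma may_move_cycle: "may_move C (g i) (g (i + 1))" "may_move C (g (i + 1)) (g i)"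
  using cycle_vertex_less by (simp_all add: may_move_def adjacent_cycle Suc_cycle_vertex)

lemma may_move_cycleE:
  assumes "may_move C (g p) w"
  obtains q where "w = g q" "q = p \<or> q = p + 1 \<or> q = p - 1"
proof -
  consider "w = g p" | "w = g (p + 1)" | "w < m" "g p = Suc w mod m"
    using assms by (auto simp: may_move_def adjacent_cycle Suc_cycle_vertex)
  then show thesis
  proof cases
    case 3
    then have "g p = g (int w + 1)" using Suc_cycle_vertex[of "int w"] by (simp add: cycle_vertex_of_nat)
    then have "g (p - 1) = g (int w)" by (simp add: cycle_vertex_eq_iff algebra_simps)
    then show thesis using 3 by (intro that[of "p - 1"]) (simp_all add: cycle_vertex_of_nat)
  qed (use that in blast)+
qed

lemma cycle_vertex_cover:
  assumes "u < m"
  obtains t where "i \<le> t" "t < i + int m" "u = g t"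
proof
  let ?t = "i + (int u - i) mod int m"
  show "i \<le> ?t" "?t < i + int m" using m by simp_all
  have "g ?t = g (int u)" unfolding cycle_vertex_def by (simp add: mod_add_right_eq)
  then show "u = g ?t" using assms by (simp add: cycle_vertex_of_nat)
qed

lemma wins_cycle_doneI:
  assumes "\<And>t. i + 2 \<le> t \<Longrightarrow> t < i + int m \<Longrightarrow> g t \<in> D"
  shows "wins C 2 c x y D"
proof (rule wins_doneI[of _ _ "g i" "g (i + 1)"], rule subsetI)
  fix u assume "u \<in> verts C"
  then obtain t where "i \<le> t" "t < i + int m" "u = g t" using cycle_vertex_cover[of u i] by auto
  then show "u \<in> D \<union> {g i, g (i + 1)}" 
    using assms[of t] by (cases "t = i"; cases "t = i + 1") auto
qed

text \<open>R only has to survive one more round on \<open>p + 2\<close>. One cop move cannot reach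
  it, since \<open>p - 1\<close> and \<open>p + 2\<close> are distinct modulo \<open>m\<close> for
  \<open>m >= 4\<close>.\<close>

lemma wins_cycle_ahead:
  assumes "4 \<le> m" "\<And>t. p + 3 \<le> t \<Longrightarrow> t < p + int m \<Longrightarrow> g t \<in> D"
  shows "wins C 2 (g p) x (Some (g (p + 2))) D"
proof (rule wins_step)
  fix c assume "may_move C (g p) c"
  then obtain q where q: "c = g q" "q = p \<or> q = p + 1 \<or> q = p - 1" by (rule may_move_cycleE)
  let ?x = "stay c x"
  have y: "robber_step C c (Some (g (p + 2))) (Some (g (p + 2)))"
    unfolding q(1) by (intro robber_moveI cycle_vertex_neq) (use q assms(1) in auto)
  have w: "wins C 2 c ?x (Some (g (p + 2))) (D \<union> hit x ?x \<union> hit (Some (g (p + 2))) (Some (g (p + 2))))"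
    unfolding hit_simps
  proof (rule wins_cycle_doneI[of p])
    show "g t \<in> D \<union> hit x ?x \<union> {g (p + 2)}" if "p + 2 \<le> t" "t < p + int m" for t
      using assms(2)[of t] that by (cases "t = p + 2") auto
  qed
  show "\<exists>x' y'. robber_step C c x x' \<and> robber_step C c (Some (g (p + 2))) y' \<and>
      wins C 2 c x' y' (D \<union> hit x x' \<union> hit (Some (g (p + 2))) y')"
    by (rule exI, rule exI, rule conjI[OF robber_step_stay conjI[OF y w]])
qed

text \<open>Only \<open>p - 1\<close>, \<open>p\<close>, \<open>p + 1\<close> are left. A cop who
  captures L on \<open>p - 1\<close> is again two away from \<open>p + 1\<close>, where R steps; any
  other move lets L damage \<open>p - 1\<close>.\<close>

lemma wins_cycle_entered:
  assumes "4 \<le> m" "\<And>t. p + 2 \<le> t \<Longrightarrow> t \<le> p + int m - 2 \<Longrightarrow> g t \<in> D"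
  shows "wins C 2 (g p) (Some (g (p - 1))) (Some (g (p + 2))) D"
proof (rule wins_step)
  fix c assume "may_move C (g p) c"
  then obtain q where q: "c = g q" "q = p \<or> q = p + 1 \<or> q = p - 1" by (rule may_move_cycleE)
  let ?x = "g (p - 1)" and ?y = "g (p + 2)"
  show "\<exists>x' y'. robber_step C c (Some ?x) x' \<and> robber_step C c (Some ?y) y' \<and>
      wins C 2 c x' y' (D \<union> hit (Some ?x) x' \<union> hit (Some ?y) y')"
  proof (cases "q = p - 1")
    case True
    have e: "p + 1 = q + 2" using True by simp
    have "robber_step C c (Some ?y) (Some (g (p + 1)))"
      unfolding q(1) using may_move_cycle(2)[of "p + 1"] True assms(1)
      by (intro robber_moveI cycle_vertex_neq) (auto simp: add.assoc)
    moreover have "wins C 2 (g q) None (Some (g (q + 2))) (D \<union> {?y})"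
      by (rule wins_cycle_ahead) (use assms True in auto)
    moreover have "robber_step C c (Some ?x) None" by (simp add: q(1) True)
    ultimately show ?thesis unfolding e q(1)
      by (intro exI[of _ None] exI[of _ "Some (g (q + 2))"]) simp
  next
    case False
    have "robber_step C c (Some ?x) (Some ?x)" "robber_step C c (Some ?y) (Some ?y)"
      unfolding q(1) by (intro robber_moveI cycle_vertex_neq; use q False assms(1) in auto)+
    moreover have "wins C 2 c (Some ?x) (Some ?y) (D \<union> {?x} \<union> {?y})"
    proof (rule wins_cycle_doneI[of p])
      show "g t \<in> D \<union> {?x} \<union> {?y}" if "p + 2 \<le> t" "t < p + int m" for t
      proof (cases "t = p - 1 + int m")
        case True
        then show ?thesis using cycle_vertex_shift[of "p - 1"] by simp
      next
        case False
        then show ?thesis using assms(2)[of t] that by simp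
      qed
    qed
    ultimately show ?thesis by (intro exI[of _ "Some ?x"] exI[of _ "Some ?y"]) simp
  qed
qed

text \<open>Positions are lifted to the integers, the universal cover of the cycle: the left robber \<open>l\<close>
  lies between the right robber \<open>p + 2\<close> and the next copy \<open>p + m\<close> of the cop, and \<open>a\<close> is the least
  position the cop has taken.\<close>

lemma wins_cycle_follow:
  assumes "4 \<le> m" "a \<le> p" "p + 2 \<le> l" "l + 2 \<le> p + int m"
    "\<And>t. a + 2 \<le> t \<Longrightarrow> t < l \<Longrightarrow> g t \<in> D \<or> g t = g (p + 2)"
  shows "wins C 2 (g p) (Some (g l)) (Some (g (p + 2))) D"
  using assms(2-)
\<comment> \<open>As on the path, one step of L outweighs one step of the cop.\<close>
proof (induction "nat (p + a + 2 * int m - 2 * l)" arbitrary: p a l D rule: less_induct)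
  case less
  show ?case
  proof (rule wins_step)
    fix c assume "may_move C (g p) c"
    then obtain q where q: "c = g q" "q = p \<or> q = p + 1 \<or> q = p - 1" by (rule may_move_cycleE)
    let ?x = "Some (g l)" and ?y = "Some (g (p + 2))" and ?D = "D \<union> {g l} \<union> {g (p + 2)}"
    have cov: "g t \<in> ?D" if "a + 2 \<le> t" "t \<le> l" for t
      using less.prems(4)[of t] that by (cases "t = l") auto
    have x_safe: "g l \<noteq> g q" and y_safe: "g (p + 2) \<noteq> g q"
      by (intro cycle_vertex_neq; use q(2) less.prems assms(1) in auto)+
    have x_stay: "robber_step C c ?x ?x" and y_stay: "robber_step C c ?y ?y"
      unfolding q(1) by (intro robber_moveI x_safe y_safe may_move_refl)+
    have "may_move C (g (p + 2)) (g (q + 2))"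
      using q(2) may_move_cycle(1)[of "p + 2"] may_move_cycle(2)[of "p + 1"] by (auto simp: algebra_simps)
    then have y_move: "robber_step C c ?y (Some (g (q + 2)))"
      unfolding q(1) by (intro robber_moveI y_safe cycle_vertex_neq(2)[of q "q + 2"]) (use assms(1) in auto)
    have x_move: "robber_step C c ?x (Some (g (l + 1)))" if "l + 2 \<le> q + int m"
      unfolding q(1)
      by (intro robber_moveI x_safe may_move_cycle(1) cycle_vertex_neq(2)[of q "l + 1"])
        (use that q(2) less.prems in auto)
    have moveI: "\<exists>x' y'. robber_step C c ?x x' \<and> robber_step C c ?y y' \<and>
        wins C 2 c x' y' (D \<union> hit ?x x' \<union> hit ?y y')"
      if "robber_step C c ?x (Some x)" "robber_step C c ?y (Some y)" "wins C 2 (g q) (Some x) (Some y) ?D" for x y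
      using that q(1) by (intro exI[of _ "Some x"] exI[of _ "Some y"]) simp
    \<comment> \<open>If the cop falls back past \<open>a\<close>, the one new position is
      \<open>q + 2\<close>, where R steps; the second disjunct of the invariant allows for
      it.\<close>
    have inv: "g t \<in> ?D \<or> g t = g (q + 2)" if "min a q + 2 \<le> t" "t \<le> l" for t
    proof (cases "a + 2 \<le> t")
      case False
      then have "t = q + 2" using that q(2) less.prems(1) by auto
      then show ?thesis by simp
    qed (use cov that in blast)
    \<comment> \<open>Only \<open>a\<close> and \<open>a + 1\<close> are left (1), L advances (2), L
      enters next to the cop (3), the cop comes next to L and R needs one more round on
      \<open>q + 2\<close> (4), or L waits at distance 2 (5).\<close>
    consider "a + int m \<le> l + 1" | "l < a + int m - 1" "l + 3 \<le> q + int m"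
      | "a = p" "q = p" "l = p + int m - 2" | "a = p" "q = p - 1" "l = p + int m - 2"
      | "l < a + int m - 1" "q = p - 1" "l = q + int m - 2"
      using q(2) less.prems(1-3) by linarith
    then show "\<exists>x' y'. robber_step C c ?x x' \<and> robber_step C c ?y y' \<and>
        wins C 2 c x' y' (D \<union> hit ?x x' \<union> hit ?y y')"
    proof cases
      case 1
      show ?thesis
        by (rule moveI[OF x_stay y_stay], rule wins_cycle_doneI[of a], rule cov) (use 1 in auto)
    next
      case 2
      have "wins C 2 (g q) (Some (g (l + 1))) (Some (g (q + 2))) ?D"
      proof (rule less.hyps[where a = "min a q"])
        show "g t \<in> ?D \<or> g t = g (q + 2)" if "min a q + 2 \<le> t" "t < l + 1" for t
          using that by (intro inv) auto
        show "nat (q + min a q + 2 * int m - 2 * (l + 1)) < nat (p + a + 2 * int m - 2 * l)"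
          using 2 less.prems q(2) by auto
      qed (use 2 q(2) less.prems in auto)
      then show ?thesis using 2 by (intro moveI[OF x_move y_move]) auto
    next
      case 3
      have "g (l + 1) = g (p - 1)" using cycle_vertex_shift[of "p - 1"] by (simp add: 3 algebra_simps)
      moreover have "wins C 2 (g p) (Some (g (p - 1))) (Some (g (p + 2))) ?D"
        by (rule wins_cycle_entered[OF assms(1)], rule cov) (use 3 in auto)
      ultimately have "wins C 2 (g q) (Some (g (l + 1))) (Some (g (q + 2))) ?D" using 3(2) by simp
      then show ?thesis using 3 by (intro moveI[OF x_move y_move]) auto
    next
      case 4
      have "wins C 2 (g q) (Some (g l)) (Some (g (q + 2))) ?D"
        by (rule wins_cycle_ahead[OF assms(1)], rule cov) (use 4 in auto)
      then show ?thesis by (rule moveI[OF x_stay y_move])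
    next
      case 5
      have "wins C 2 (g q) (Some (g l)) (Some (g (q + 2))) ?D"
      proof (rule less.hyps[where a = "min a q"])
        show "g t \<in> ?D \<or> g t = g (q + 2)" if "min a q + 2 \<le> t" "t < l" for t
          using that by (intro inv) auto
        show "nat (q + min a q + 2 * int m - 2 * l) < nat (p + a + 2 * int m - 2 * l)"
          using 5 less.prems by auto
      qed (use 5 assms(1) in auto)
      then show ?thesis by (rule moveI[OF x_stay y_move])
    qed
  qed
qed

end

text \<open>The cop can move onto only one of \<open>u\<close> and \<open>w\<close>; the robber on
  the other one waits and damages it.\<close>

lemma wins_three_vertices:
  assumes "verts G \<subseteq> {c, u, w}" "u \<noteq> w"
  shows "wins G 2 c (Some u) (Some w) {}"
proof (rule wins_step)
  fix q
  let ?x = "stay q (Some u)" and ?y = "stay q (Some w)"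
  have w: "wins G 2 q ?x ?y ({} \<union> hit (Some u) ?x \<union> hit (Some w) ?y)"
  proof (cases "q = u")
    case True
    then show ?thesis using assms
      by (intro wins_doneI[of _ _ c u]) (auto simp: stay_def status_def)
  next
    case False
    then show ?thesis using assms
      by (intro wins_doneI[of _ _ c w]) (auto simp: stay_def status_def)
  qed
  show "\<exists>x' y'. robber_step G q (Some u) x' \<and> robber_step G q (Some w) y' \<and>
      wins G 2 q x' y' ({} \<union> hit (Some u) x' \<union> hit (Some w) y')"
    by (rule exI, rule exI, rule conjI[OF robber_step_stay conjI[OF robber_step_stay w]])
qed

lemma robbers_leave_cycle:
  assumes "3 \<le> m"
  shows "robbers_leave (cycle_graph m) 2"
  unfolding robbers_leave_def
proof
  fix c assume "c \<in> verts (cycle_graph m)"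
  then have c: "c < m" by simp
  have "\<exists>u w. u < m \<and> w < m \<and> u \<noteq> c \<and> w \<noteq> c \<and> wins (cycle_graph m) 2 c (Some u) (Some w) {}"
  proof (cases "m = 3")
    case True
    then have V: "{..<m} = {0, 1, 2}" by auto
    consider "c = 0" | "c = 1" | "c = 2" using c True by linarith
    then obtain u w where uw: "u < m" "w < m" "u \<noteq> c" "w \<noteq> c" "u \<noteq> w" "{..<m} \<subseteq> {c, u, w}"
    proof cases
      case 1
      show thesis by (rule that[of 1 2]) (use True 1 V in auto)
    next
      case 2
      show thesis by (rule that[of 0 2]) (use True 2 V in auto)
    next
      case 3
      show thesis by (rule that[of 0 1]) (use True 3 V in auto)
    qed
    then have "wins (cycle_graph m) 2 c (Some u) (Some w) {}" by (intro wins_three_vertices) simp_all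
    with uw show ?thesis by blast
  next
    case False
    let ?g = "cycle_vertex m" and ?p = "int c"
    have "wins (cycle_graph m) 2 (?g ?p) (Some (?g (?p + 2))) (Some (?g (?p + 2))) {}"
      by (rule wins_cycle_follow[where a = ?p]) (use assms False in auto)
    moreover have "?g (?p + 2) \<noteq> ?g ?p" by (rule cycle_vertex_neq) (use assms in auto)
    ultimately show ?thesis
      using cycle_vertex_less[OF assms] cycle_vertex_of_nat[OF assms c] by metis
  qed
  then obtain u w where "u < m" "w < m" "u \<noteq> c" "w \<noteq> c" "wins (cycle_graph m) 2 c (Some u) (Some w) {}"
    by blast
  then show "\<exists>x y. robber_start (cycle_graph m) c x \<and> robber_start (cycle_graph m) c y \<and>
      wins (cycle_graph m) 2 c x y {}"
    unfolding robber_start_def status_def by (intro exI[of _ "Some u"] exI[of _ "Some w"]) auto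
qed

section \<open>The small graphs\<close>

text \<open>The cop never leaves her component, so robbers elsewhere are safe. In two rounds each
  damages its whole component by moving to a partner vertex and waiting there; an isolated vertex is
  its own partner.\<close>

lemma robbers_leave_degree_1:
  assumes G: "simple_graph G" and degree: "\<forall>x\<in>verts G. card (nbrs G x) \<le> 1"
    and away: "\<forall>c\<in>verts G. \<exists>u\<in>verts G. \<exists>w\<in>verts G.
      u \<notin> insert c (nbrs G c) \<and> w \<notin> insert c (nbrs G c) \<and>
      card (verts G - (insert u (nbrs G u) \<union> insert w (nbrs G w))) \<le> k"
  shows "robbers_leave G k"
  unfolding robbers_leave_def
proof
  fix c assume c: "c \<in> verts G"
  let ?C = "insert c (nbrs G c)"
  obtain u w where uw: "u \<in> verts G" "w \<in> verts G" "u \<notin> ?C" "w \<notin> ?C"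
    and few: "card (verts G - (insert u (nbrs G u) \<union> insert w (nbrs G w))) \<le> k"
    using away c by blast
  have deg: "card (nbrs G x) \<le> 1" if "x \<in> verts G" for x using degree that by blast
  have partner: "\<exists>x'. insert x (nbrs G x) = {x, x'} \<and> may_move G x x' \<and> x' \<notin> ?C"
    if x: "x \<in> verts G" "x \<notin> ?C" for x
  proof (cases "nbrs G x = {}")
    case True
    then show ?thesis using x by (intro exI[of _ x]) auto
  next
    case False
    then obtain x' where x': "adjacent G x x'" by auto
    then have "nbrs G x = {x'}" by (rule nbrs_eq_singleton[OF G deg[OF x(1)]])
    moreover have "x' \<notin> ?C"
      using adj_closed_Compl[OF adj_closed_nbrs[OF G deg, of c]] x(2) x' unfolding adj_closed_def
      by fastforce
    ultimately show ?thesis using x' by (intro exI[of _ x']) (auto simp: may_move_def)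
  qed
  obtain u' where u': "insert u (nbrs G u) = {u, u'}" "may_move G u u'" "u' \<notin> ?C"
    using partner uw by blast
  obtain w' where w': "insert w (nbrs G w) = {w, w'}" "may_move G w w'" "w' \<notin> ?C"
    using partner uw by blast
  have second: "wins G k q (Some u') (Some w') {u, w}" if q: "q \<in> ?C" for q
  proof (rule wins_step)
    fix q' assume "may_move G q q'"
    then have "q' \<in> ?C" using adj_closed_nbrs[OF G deg, of c] q
      unfolding adj_closed_def may_move_def by (metis mem_nbrs subsetD)
    then have "robber_step G q' (Some u') (Some u')" "robber_step G q' (Some w') (Some w')"
      by (intro robber_moveI; use u' w' in auto)+
    moreover have "wins G k q' (Some u') (Some w') ({u, w} \<union> {u'} \<union> {w'})"
    proof (rule wins_done)
      have "insert u (nbrs G u) \<union> insert w (nbrs G w) = {u, w} \<union> {u'} \<union> {w'}"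
        unfolding u'(1) w'(1) by auto
      with few show "card (verts G - ({u, w} \<union> {u'} \<union> {w'})) \<le> k" by simp
    qed
    ultimately show "\<exists>x' y'. robber_step G q' (Some u') x' \<and> robber_step G q' (Some w') y' \<and>
        wins G k q' x' y' ({u, w} \<union> hit (Some u') x' \<union> hit (Some w') y')"
      by (intro exI[of _ "Some u'"] exI[of _ "Some w'"]) simp
  qed
  have "wins G k c (Some u) (Some w) {}"
  proof (rule wins_step)
    fix q assume "may_move G c q"
    then have q: "q \<in> ?C" by (auto simp: may_move_def)
    then have "robber_step G q (Some u) (Some u')" "robber_step G q (Some w) (Some w')"
      by (intro robber_moveI; use uw u' w' in auto)+
    moreover have "wins G k q (Some u') (Some w') ({} \<union> {u} \<union> {w})"
      using second[OF q] by (simp add: insert_commute)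
    ultimately show "\<exists>x' y'. robber_step G q (Some u) x' \<and> robber_step G q (Some w) y' \<and>
        wins G k q x' y' ({} \<union> hit (Some u) x' \<union> hit (Some w) y')"
      by (intro exI[of _ "Some u'"] exI[of _ "Some w'"]) simp
  qed
  then show "\<exists>x y. robber_start G c x \<and> robber_start G c y \<and> wins G k c x y {}"
    unfolding robber_start_def status_def using uw
    by (intro exI[of _ "Some u"] exI[of _ "Some w"]) auto
qed

section \<open>Explicit computation of the small disjoint unions\<close>

lemma verts_disjoint_union:
  "verts (G \<union>\<^sub>g H) = (\<lambda>x. 2 * x) ` verts G \<union> (\<lambda>x. Suc (2 * x)) ` verts H"
  by (auto simp: disjoint_union_def Plus_def image_Un image_image sum_encode_def)

lemma adjacent_disjoint_union:
  "adjacent (G \<union>\<^sub>g H) u v \<longleftrightarrow>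
     (\<exists>x y. adjacent G x y \<and> u = 2 * x \<and> v = 2 * y) \<or>
     (\<exists>x y. adjacent H x y \<and> u = Suc (2 * x) \<and> v = Suc (2 * y))"
proof -
  have image: "{u, v} \<in> (`) h ` E \<longleftrightarrow> (\<exists>x y. {x, y} \<in> E \<and> u = h x \<and> v = h y)"
    if "inj h" for h :: "nat \<Rightarrow> nat" and E
  proof
    assume "{u, v} \<in> (`) h ` E"
    then obtain e where e: "e \<in> E" "{u, v} = h ` e" by blast
    then obtain x y where xy: "x \<in> e" "y \<in> e" "u = h x" "v = h y" by blast
    then have "h ` e = h ` {x, y}" using e by simp
    then have "e = {x, y}" by (simp only: inj_image_eq_iff[OF that])
    then show "\<exists>x y. {x, y} \<in> E \<and> u = h x \<and> v = h y" using e xy by blast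
  next
    assume "\<exists>x y. {x, y} \<in> E \<and> u = h x \<and> v = h y"
    then obtain x y where xy: "{x, y} \<in> E" "u = h x" "v = h y" by blast
    show "{u, v} \<in> (`) h ` E"
      by (rule image_eqI[OF _ xy(1)]) (simp add: xy(2,3))
  qed
  have "edges (G \<union>\<^sub>g H) = (`) (\<lambda>x. 2 * x) ` edges G \<union> (`) (\<lambda>x. Suc (2 * x)) ` edges H"
    by (simp add: disjoint_union_def image_image sum_encode_def)
  then show ?thesis unfolding adjacent_def by (simp add: image inj_def)
qed

lemma verts_complete [simp]: "verts (complete_graph m) = {..<m}"
  by (simp add: complete_graph_def)

lemma adjacent_complete: "adjacent (complete_graph m) u v \<longleftrightarrow> u < m \<and> v < m \<and> u \<noteq> v"
  by (auto simp: adjacent_def complete_graph_def card_insert_if)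

lemma verts_empty [simp]: "verts (empty_graph m) = {..<m}"
  by (simp add: empty_graph_def)

lemma adjacent_empty [simp]: "\<not> adjacent (empty_graph m) u v"
  by (simp add: adjacent_def empty_graph_def)

lemma simple_empty: "simple_graph (empty_graph m)"
  by (simp add: simple_graph_def empty_graph_def)

lemma simple_complete: "simple_graph (complete_graph m)"
  by (simp add: simple_graph_def complete_graph_def)

lemma simple_disjoint_union:
  assumes "simple_graph G" "simple_graph H"
  shows "simple_graph (G \<union>\<^sub>g H)"
proof -
  have edge: "h ` e \<subseteq> h ` verts F \<and> card (h ` e) = 2"
    if "simple_graph F" "e \<in> edges F" "inj h" for F e and h :: "nat \<Rightarrow> nat"
    using that by (auto simp: simple_graph_def card_image inj_on_subset)
  have "edges (G \<union>\<^sub>g H) = (`) (\<lambda>x. 2 * x) ` edges G \<union> (`) (\<lambda>x. Suc (2 * x)) ` edges H"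
    by (simp add: disjoint_union_def image_image sum_encode_def)
  moreover have "finite (verts (G \<union>\<^sub>g H))"
    using assms by (simp add: verts_disjoint_union simple_graph_def)
  moreover have "f \<subseteq> verts (G \<union>\<^sub>g H) \<and> card f = 2"
    if "f \<in> (`) (\<lambda>x. 2 * x) ` edges G \<union> (`) (\<lambda>x. Suc (2 * x)) ` edges H" for f
    using that
  proof
    assume "f \<in> (`) (\<lambda>x. 2 * x) ` edges G"
    then obtain e where "e \<in> edges G" "f = (\<lambda>x. 2 * x) ` e" by blast
    then show ?thesis using edge[OF assms(1), of e "\<lambda>x. 2 * x"]
      by (simp add: verts_disjoint_union le_supI1 inj_def)
  next
    assume "f \<in> (`) (\<lambda>x. Suc (2 * x)) ` edges H"
    then obtain e where "e \<in> edges H" "f = (\<lambda>x. Suc (2 * x)) ` e" by blast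
    then show ?thesis using edge[OF assms(2), of e "\<lambda>x. Suc (2 * x)"]
      by (simp add: verts_disjoint_union le_supI2 inj_def)
  qed
  ultimately show ?thesis unfolding simple_graph_def by simp
qed

abbreviation "K \<equiv> complete_graph"

lemma lessThan_small: "{..<1::nat} = {0}" "{..<2::nat} = {0, 1}" "{..<4::nat} = {0, 1, 2, 3}"
  by auto

text \<open>\<open>sum_encode\<close> sends the left part to \<open>2 * x\<close> and the right part
  to \<open>2 * x + 1\<close>. As the union associates to the left, the components of a triple union
  are \<open>{0, 4}\<close>, \<open>{2}\<close> or \<open>{2, 6}\<close>, and \<open>{1}\<close> or
  \<open>{1, 3}\<close>.\<close>

lemma verts_small:
  "verts (K 2 \<union>\<^sub>g K 1) = {0, 2, 1}"
  "verts (K 2 \<union>\<^sub>g K 2) = {0, 2, 1, 3}"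
  "verts (K 2 \<union>\<^sub>g K 1 \<union>\<^sub>g K 1) = {0, 4, 2, 1}"
  "verts (K 2 \<union>\<^sub>g K 2 \<union>\<^sub>g K 1) = {0, 4, 2, 6, 1}"
  "verts (K 2 \<union>\<^sub>g K 2 \<union>\<^sub>g K 2) = {0, 4, 2, 6, 1, 3}"
  by (simp_all add: verts_disjoint_union lessThan_small lessThan_Suc insert_commute)

text \<open>\<open>Suc 0\<close> is the simp normal form of \<open>1\<close>.\<close>

lemma adjacent_K1: "\<not> adjacent (K (Suc 0)) x y"
  by (auto simp: adjacent_complete)

lemma adjacent_K2: "adjacent (K 2) x y \<longleftrightarrow> x = 0 \<and> y = 1 \<or> x = 1 \<and> y = 0"
  by (auto simp: adjacent_complete)

lemma adjacent_small:
  "adjacent (K 2 \<union>\<^sub>g K 1) x y \<longleftrightarrow> x = 0 \<and> y = 2 \<or> x = 2 \<and> y = 0"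
  "adjacent (K 2 \<union>\<^sub>g K 2) x y \<longleftrightarrow> x = 0 \<and> y = 2 \<or> x = 2 \<and> y = 0 \<or> x = 1 \<and> y = 3 \<or> x = 3 \<and> y = 1"
  "adjacent (K 2 \<union>\<^sub>g K 1 \<union>\<^sub>g K 1) x y \<longleftrightarrow> x = 0 \<and> y = 4 \<or> x = 4 \<and> y = 0"
  "adjacent (K 2 \<union>\<^sub>g K 2 \<union>\<^sub>g K 1) x y \<longleftrightarrow> x = 0 \<and> y = 4 \<or> x = 4 \<and> y = 0 \<or> x = 2 \<and> y = 6 \<or> x = 6 \<and> y = 2"
  "adjacent (K 2 \<union>\<^sub>g K 2 \<union>\<^sub>g K 2) x y \<longleftrightarrow> x = 0 \<and> y = 4 \<or> x = 4 \<and> y = 0 \<or> x = 2 \<and> y = 6 \<or> x = 6 \<and> y = 2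
     \<or> x = 1 \<and> y = 3 \<or> x = 3 \<and> y = 1"
  by (auto simp: adjacent_disjoint_union adjacent_K1 adjacent_K2)

lemma nbrs_small:
  "nbrs (empty_graph m) x = {}"
  "nbrs (K 2 \<union>\<^sub>g K 1) x = (if x = 0 then {2} else if x = 2 then {0} else {})"
  "nbrs (K 2 \<union>\<^sub>g K 2) x = (if x = 0 then {2} else if x = 2 then {0} else if x = 1 then {3} else if x = 3 then {1} else {})"
  "nbrs (K 2 \<union>\<^sub>g K 1 \<union>\<^sub>g K 1) x = (if x = 0 then {4} else if x = 4 then {0} else {})"
  "nbrs (K 2 \<union>\<^sub>g K 2 \<union>\<^sub>g K 1) x =
    (if x = 0 then {4} else if x = 4 then {0} else if x = 2 then {6} else if x = 6 then {2} else {})"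
  "nbrs (K 2 \<union>\<^sub>g K 2 \<union>\<^sub>g K 2) x =
    (if x = 0 then {4} else if x = 4 then {0} else if x = 2 then {6} else if x = 6 then {2}
     else if x = 1 then {3} else if x = 3 then {1} else {})"
  unfolding nbrs_def adjacent_small by auto

lemmas small_simps = verts_small lessThan_small verts_empty nbrs_small
lemmas simple_small = simple_disjoint_union[OF simple_complete simple_complete]
  simple_disjoint_union[OF simple_disjoint_union[OF simple_complete simple_complete] simple_complete]

lemma robbers_leave_small:
  assumes "H \<in> small_family"
  shows "robbers_leave H 2"
proof -
  have "robbers_leave (empty_graph 4) 2"
    by (rule robbers_leave_degree_1[OF simple_empty]; unfold small_simps; simp add: insert_Diff_if)
  moreover have "robbers_leave (K 2 \<union>\<^sub>g K 1) 2"
    by (rule robbers_leave_degree_1[OF simple_small(1)]; unfold small_simps; simp add: insert_Diff_if)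
  moreover have "robbers_leave (K 2 \<union>\<^sub>g K 2) 2"
    by (rule robbers_leave_degree_1[OF simple_small(1)]; unfold small_simps; simp add: insert_Diff_if)
  moreover have "robbers_leave (K 2 \<union>\<^sub>g K 1 \<union>\<^sub>g K 1) 2"
    by (rule robbers_leave_degree_1[OF simple_small(2)]; unfold small_simps; simp add: insert_Diff_if)
  moreover have "robbers_leave (K 2 \<union>\<^sub>g K 2 \<union>\<^sub>g K 1) 2"
    apply (rule robbers_leave_degree_1[OF simple_small(2)]; unfold small_simps)
     apply simp
    \<comment> \<open>The witnesses represent the two components without the cop; only her own, of
      at most two vertices, remains undamaged.\<close>
    apply (intro ballI, elim insertE emptyE; hypsubst)
        apply (rule bexI[of _ 2], rule bexI[of _ 1]; simp add: insert_Diff_if)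
       apply (rule bexI[of _ 2], rule bexI[of _ 1]; simp add: insert_Diff_if)
      apply (rule bexI[of _ 0], rule bexI[of _ 1]; simp add: insert_Diff_if)
     apply (rule bexI[of _ 0], rule bexI[of _ 1]; simp add: insert_Diff_if)
    apply (rule bexI[of _ 0], rule bexI[of _ 2]; simp add: insert_Diff_if)
    done
  moreover have "robbers_leave (K 2 \<union>\<^sub>g K 2 \<union>\<^sub>g K 2) 2"
    apply (rule robbers_leave_degree_1[OF simple_small(2)]; unfold small_simps)
     apply simp
    apply (intro ballI, elim insertE emptyE; hypsubst)
         apply (rule bexI[of _ 2], rule bexI[of _ 1]; simp add: insert_Diff_if)
        apply (rule bexI[of _ 2], rule bexI[of _ 1]; simp add: insert_Diff_if)
       apply (rule bexI[of _ 0], rule bexI[of _ 1]; simp add: insert_Diff_if)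
      apply (rule bexI[of _ 0], rule bexI[of _ 1]; simp add: insert_Diff_if)
     apply (rule bexI[of _ 0], rule bexI[of _ 2]; simp add: insert_Diff_if)
    apply (rule bexI[of _ 0], rule bexI[of _ 2]; simp add: insert_Diff_if)
    done
  ultimately show ?thesis using assms unfolding small_family_def by blast
qed

section \<open>Graphs of maximum degree two\<close>

definition is_path :: "'a ugraph \<Rightarrow> 'a list \<Rightarrow> bool" where
  "is_path G xs \<longleftrightarrow> distinct xs \<and> set xs \<subseteq> verts G \<and>
     (\<forall>i. Suc i < length xs \<longrightarrow> adjacent G (xs ! i) (xs ! Suc i))"

lemma is_path_rev:
  assumes "is_path G xs"
  shows "is_path G (rev xs)"
proof -
  have "adjacent G (rev xs ! i) (rev xs ! Suc i)" if "Suc i < length xs" for i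
  proof -
    let ?j = "length xs - Suc (Suc i)"
    have "length xs - Suc i = Suc ?j" using that by simp
    then have "rev xs ! i = xs ! Suc ?j" "rev xs ! Suc i = xs ! ?j"
      using that by (simp_all add: rev_nth)
    moreover have "adjacent G (xs ! ?j) (xs ! Suc ?j)"
      using assms that by (simp add: is_path_def)
    ultimately show ?thesis by (simp add: adjacent_sym)
  qed
  then show ?thesis using assms by (simp add: is_path_def)
qed

lemma is_path_Cons:
  assumes "is_path G xs" "xs \<noteq> []" "adjacent G y (xs ! 0)" "y \<in> verts G" "y \<notin> set xs"
  shows "is_path G (y # xs)"
  using assms by (auto simp: is_path_def nth_Cons split: nat.split)

lemma obtain_longest_path:
  assumes "simple_graph G" "is_path G xs"
  obtains ys where "is_path G ys" "length xs \<le> length ys" "\<And>zs. is_path G zs \<Longrightarrow> length zs \<le> length ys"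
proof -
  have bound: "length zs < Suc (card (verts G))" if "is_path G zs" for zs
  proof -
    have "length zs = card (set zs)" using that by (simp add: is_path_def distinct_card)
    also have "\<dots> \<le> card (verts G)"
      using that by (intro card_mono finite_verts[OF assms(1)]) (simp add: is_path_def)
    finally show ?thesis by simp
  qed
  obtain ys where "is_path G ys" "\<forall>zs. is_path G zs \<longrightarrow> length zs \<le> length ys"
    using ex_has_greatest_nat[of "is_path G" xs length] assms(2) bound by blast
  then show thesis using that assms(2) by blast
qed

section \<open>Neighbourhoods along a longest path\<close>

context
  fixes G :: "'a ugraph" and xs :: "'a list"
  assumes G: "simple_graph G" and deg: "\<And>v. v \<in> verts G \<Longrightarrow> card (nbrs G v) \<le> 2"
    and path: "is_path G xs" and len: "3 \<le> length xs"
    and longest: "\<And>zs. is_path G zs \<Longrightarrow> length zs \<le> length xs"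
begin

lemma nbrs_first: "nbrs G (xs ! 0) \<subseteq> set xs"
proof
  fix y assume y: "y \<in> nbrs G (xs ! 0)"
  show "y \<in> set xs"
  proof (rule ccontr)
    assume "y \<notin> set xs"
    then have "is_path G (y # xs)"
      using y path len adjacent_vertsD(2)[OF G] by (intro is_path_Cons) (auto simp: adjacent_sym)
    then show False using longest by fastforce
  qed
qed

lemma nbrs_last: "nbrs G (xs ! (length xs - 1)) \<subseteq> set xs"
proof
  fix y assume y: "y \<in> nbrs G (xs ! (length xs - 1))"
  show "y \<in> set xs"
  proof (rule ccontr)
    assume "y \<notin> set xs"
    moreover have "rev xs ! 0 = xs ! (length xs - 1)" using len by (subst rev_nth) auto
    ultimately have "is_path G (y # rev xs)"
      using y is_path_rev[OF path] len adjacent_vertsD(2)[OF G]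
      by (intro is_path_Cons) (auto simp: adjacent_sym)
    then show False using longest by fastforce
  qed
qed

lemma nbrs_inner:
  assumes "Suc (Suc i) < length xs"
  shows "nbrs G (xs ! Suc i) = {xs ! i, xs ! Suc (Suc i)}"
proof -
  have dist: "xs ! i \<noteq> xs ! Suc (Suc i)"
    using path assms by (simp add: is_path_def nth_eq_iff_index_eq)
  have "{xs ! i, xs ! Suc (Suc i)} \<subseteq> nbrs G (xs ! Suc i)"
    using path assms by (simp add: is_path_def adjacent_sym[of G "xs ! Suc i" "xs ! i"])
  moreover have "card (nbrs G (xs ! Suc i)) \<le> card {xs ! i, xs ! Suc (Suc i)}"
  proof -
    have "xs ! Suc i \<in> verts G"
      using path assms nth_mem[of "Suc i" xs] unfolding is_path_def by auto
    then show ?thesis using deg[of "xs ! Suc i"] dist by simp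
  qed
  ultimately show ?thesis using card_seteq[OF finite_nbrs[OF G]] by metis
qed

text \<open>A longest path cannot be extended at its ends, and its inner vertices have their full
  degree on it. So it spans a component.\<close>

lemma adj_closed_path: "adj_closed G (set xs)"
  unfolding adj_closed_def
proof
  fix x assume "x \<in> set xs"
  then obtain i where i: "i < length xs" "x = xs ! i" by (auto simp: in_set_conv_nth)
  show "nbrs G x \<subseteq> set xs"
  proof (cases "i = 0 \<or> i = length xs - 1")
    case True
    then show ?thesis using nbrs_first nbrs_last i by auto
  next
    case False
    then obtain j where "i = Suc j" "Suc (Suc j) < length xs" using i(1) by (cases i) simp_all
    then show ?thesis using nbrs_inner i by simp
  qed
qed

text \<open>An inner vertex already has its two neighbours, so the only possible chord joins the two
  ends. It decides between path and cycle.\<close>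

lemma adjacent_path_vertices:
  assumes "i < j" "j < length xs"
  shows "adjacent G (xs ! i) (xs ! j) \<longleftrightarrow>
    j = Suc i \<or> i = 0 \<and> j = length xs - 1 \<and> adjacent G (xs ! 0) (xs ! (length xs - 1))"
proof
  have eq: "xs ! k = xs ! l \<longleftrightarrow> k = l" if "k < length xs" "l < length xs" for k l
    using path that by (simp add: is_path_def nth_eq_iff_index_eq)
  assume adj: "adjacent G (xs ! i) (xs ! j)"
  show "j = Suc i \<or> i = 0 \<and> j = length xs - 1 \<and> adjacent G (xs ! 0) (xs ! (length xs - 1))"
  proof (cases i)
    case (Suc i')
    then have "xs ! j = xs ! i' \<or> xs ! j = xs ! Suc (Suc i')"
      using adj nbrs_inner[of i'] assms by (metis Suc_lessI less_trans_Suc mem_nbrs insertE singletonD)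
    then show ?thesis using assms Suc eq[of j i'] eq[of j "Suc (Suc i')"] by (cases "Suc (Suc i') < length xs") auto
  next
    case 0
    show ?thesis
    proof (cases "j = length xs - 1")
      case False
      then obtain j' where j': "j = Suc j'" "Suc (Suc j') < length xs"
        using assms 0 by (cases j) auto
      then have "xs ! 0 = xs ! j' \<or> xs ! 0 = xs ! Suc (Suc j')"
        using adj nbrs_inner[of j'] 0 adjacent_sym by (metis mem_nbrs insertE singletonD)
      moreover have "xs \<noteq> []" using len by auto
      ultimately show ?thesis using eq[of 0 j'] eq[of 0 "Suc (Suc j')"] j' 0 by auto
    qed (use 0 adj in auto)
  qed
next
  assume "j = Suc i \<or> i = 0 \<and> j = length xs - 1 \<and> adjacent G (xs ! 0) (xs ! (length xs - 1))"
  then show "adjacent G (xs ! i) (xs ! j)" using path assms by (auto simp: is_path_def)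
qed

lemma isomorphic_path_or_cycle:
  assumes "set xs = verts G"
  shows "G \<cong>\<^sub>g path_graph (length xs) \<or> G \<cong>\<^sub>g cycle_graph (length xs)"
proof -
  let ?m = "length xs" and ?closes = "adjacent G (xs ! 0) (xs ! (length xs - 1))"
  have bij: "bij_betw ((!) xs) {..<?m} (verts G)"
    using path assms by (intro bij_betw_nth) (simp_all add: is_path_def)
  have extend: "\<forall>i<?m. \<forall>j<?m. adjacent G (xs ! i) (xs ! j) \<longleftrightarrow> adjacent H i j"
    if H: "\<And>i j. i < j \<Longrightarrow> j < ?m \<Longrightarrow> adjacent H i j \<longleftrightarrow> j = Suc i \<or> i = 0 \<and> j = ?m - 1 \<and> ?closes"
      "simple_graph H" for H :: "nat ugraph"
  proof (intro allI impI)
    fix i j assume ij: "i < ?m" "j < ?m"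
    have less: "adjacent G (xs ! k) (xs ! l) \<longleftrightarrow> adjacent H k l" if "k < l" "l < ?m" for k l
      unfolding H(1)[OF that] by (rule adjacent_path_vertices[OF that])
    show "adjacent G (xs ! i) (xs ! j) \<longleftrightarrow> adjacent H i j"
    proof (cases i j rule: linorder_cases)
      case equal
      then show ?thesis
        using adjacent_vertsD(3)[OF G, of "xs ! i" "xs ! i"] adjacent_vertsD(3)[OF H(2), of i i] by blast
    next
      case greater
      then show ?thesis
        unfolding adjacent_sym[of G "xs ! i"] adjacent_sym[of H i] using ij by (intro less)
    qed (use less ij in blast)
  qed
  show ?thesis
  proof (cases ?closes)
    case True
    have "adjacent (cycle_graph ?m) i j \<longleftrightarrow> j = Suc i \<or> i = 0 \<and> j = ?m - 1 \<and> ?closes"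
      if "i < j" "j < ?m" for i j
    proof -
      have "Suc i mod ?m = Suc i" using that by simp
      moreover have "Suc j mod ?m = (if j = ?m - 1 then 0 else Suc j)"
        using that by (cases "Suc j = ?m") auto
      ultimately show ?thesis using that True by (auto simp: adjacent_cycle)
    qed
    then have "\<forall>i<?m. \<forall>j<?m. adjacent G (xs ! i) (xs ! j) \<longleftrightarrow> adjacent (cycle_graph ?m) i j"
      using len by (intro extend simple_cycle) auto
    then have "G \<cong>\<^sub>g cycle_graph ?m" using bij by (intro isomorphicI) auto
    then show ?thesis ..
  next
    case False
    then have "\<forall>i<?m. \<forall>j<?m. adjacent G (xs ! i) (xs ! j) \<longleftrightarrow> adjacent (path_graph ?m) i j"
      by (intro extend simple_path) (auto simp: adjacent_path)
    then have "G \<cong>\<^sub>g path_graph ?m" using bij by (intro isomorphicI) auto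
    then show ?thesis ..
  qed
qed

end

lemma degree_2_cases:
  assumes G: "simple_graph G" and deg: "\<And>v. v \<in> verts G \<Longrightarrow> card (nbrs G v) \<le> 2"
    and v: "v \<in> verts G" "card (nbrs G v) = 2"
  shows "dmg G 2 \<le> card (verts G) - 3 \<or> (\<exists>m\<ge>3. G \<cong>\<^sub>g path_graph m \<or> G \<cong>\<^sub>g cycle_graph m)"
proof -
  obtain a b where ab: "nbrs G v = {a, b}" "a \<noteq> b" using v(2) by (auto simp: card_2_iff)
  then have "adjacent G v a" "adjacent G v b" by (metis insertI1 insertI2 mem_nbrs)+
  then have "is_path G [a, v, b]"
    using ab(2) adjacent_vertsD[OF G, of v a] adjacent_vertsD[OF G, of v b]
    by (auto simp: is_path_def nth_Cons adjacent_sym split: nat.split)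
  then obtain xs where xs: "is_path G xs" "length [a, v, b] \<le> length xs"
      "\<And>zs. is_path G zs \<Longrightarrow> length zs \<le> length xs"
    by (rule obtain_longest_path[OF G]) blast
  then have "3 \<le> length xs" by simp
  note lp = G deg xs(1) this xs(3)
  show ?thesis
  proof (cases "set xs = verts G")
    case True
    then show ?thesis using isomorphic_path_or_cycle[OF lp] \<open>3 \<le> length xs\<close> by blast
  next
    case False
    then obtain w where w: "w \<in> verts G" "w \<notin> set xs" using xs(1) by (auto simp: is_path_def)
    \<comment> \<open>The longest path may avoid \<open>v\<close>. The cop guards its second vertex,
      which is inner and therefore of degree 2.\<close>
    have mem: "xs ! 1 \<in> set xs" using xs(2) by (intro nth_mem) simp
    have "0 < length xs" "2 < length xs" using \<open>3 \<le> length xs\<close> by linarith+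
    then have "xs ! 0 \<noteq> xs ! 2"
      using nth_eq_iff_index_eq[of xs 0 2] xs(1) unfolding is_path_def by simp
    moreover have "nbrs G (xs ! Suc 0) = {xs ! 0, xs ! Suc (Suc 0)}"
      by (rule nbrs_inner[OF lp]) (use xs(2) in auto)
    ultimately have "card (nbrs G (xs ! 1)) = 2" by (simp add: numeral_2_eq_2)
    then have "dmg G 2 \<le> card (verts G) - 3"
      using adj_closed_path[OF lp] mem w xs(1) by (intro dmg_le_disconnected[OF G]) (auto simp: is_path_def)
    then show ?thesis ..
  qed
qed

section \<open>Graphs of maximum degree one and the characterization\<close>

lemma isomorphic_edgeless:
  assumes "finite (verts G)" "\<And>u v. \<not> adjacent G u v"
  shows "G \<cong>\<^sub>g empty_graph (card (verts G))"
proof -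
  obtain f where "bij_betw f {..<card (verts G)} (verts G)"
    using ex_bij_betw_nat_finite[OF assms(1)] by (auto simp: atLeast0LessThan)
  then show ?thesis using assms(2) by (intro isomorphicI[of f]) auto
qed

lemma nbrs_path_2: "nbrs (path_graph 2) x = (if x = 0 then {1} else if x = 1 then {0} else {})"
  by (auto simp: nbrs_def adjacent_path)

lemma isomorphic_path_2:
  assumes "verts G = {a, b}" "nbrs G a = {b}" "nbrs G b = {a}" "distinct [a, b]"
  shows "G \<cong>\<^sub>g path_graph 2"
  by (rule isomorphicI[of "\<lambda>x. if x = 0 then a else b"])
    (use assms in \<open>auto simp: lessThan_small nbrs_path_2 mem_nbrs[symmetric] bij_betw_def simp del: mem_nbrs\<close>)

text \<open>The labels tested in this and the following isomorphisms are those of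
  \<open>verts_small\<close>.\<close>

lemma isomorphic_K2_K1:
  assumes "verts G = {a, b, c}" "nbrs G a = {b}" "nbrs G b = {a}" "nbrs G c = {}" "distinct [a, b, c]"
  shows "G \<cong>\<^sub>g K 2 \<union>\<^sub>g K 1"
  by (rule isomorphicI[of "\<lambda>x. if x = 0 then a else if x = 2 then b else c"]; unfold verts_small mem_nbrs[symmetric] nbrs_small)
    (use assms in \<open>auto simp: bij_betw_def simp del: mem_nbrs\<close>)

lemma isomorphic_K2_K2:
  assumes "verts G = {a, b, c, d}" "nbrs G a = {b}" "nbrs G b = {a}" "nbrs G c = {d}" "nbrs G d = {c}"
    "distinct [a, b, c, d]"
  shows "G \<cong>\<^sub>g K 2 \<union>\<^sub>g K 2"
  by (rule isomorphicI[of "\<lambda>x. if x = 0 then a else if x = 2 then b else if x = 1 then c else d"]; unfold verts_small mem_nbrs[symmetric] nbrs_small)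
    (use assms in \<open>auto simp: bij_betw_def simp del: mem_nbrs\<close>)

lemma isomorphic_K2_K1_K1:
  assumes "verts G = {a, b, c, d}" "nbrs G a = {b}" "nbrs G b = {a}" "nbrs G c = {}" "nbrs G d = {}"
    "distinct [a, b, c, d]"
  shows "G \<cong>\<^sub>g K 2 \<union>\<^sub>g K 1 \<union>\<^sub>g K 1"
  by (rule isomorphicI[of "\<lambda>x. if x = 0 then a else if x = 4 then b else if x = 2 then c else d"]; unfold verts_small mem_nbrs[symmetric] nbrs_small)
    (use assms in \<open>auto simp: bij_betw_def simp del: mem_nbrs\<close>)

lemma isomorphic_K2_K2_K1:
  assumes "verts G = {a, b, c, d, e}" "nbrs G a = {b}" "nbrs G b = {a}" "nbrs G c = {d}" "nbrs G d = {c}"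
    "nbrs G e = {}" "distinct [a, b, c, d, e]"
  shows "G \<cong>\<^sub>g K 2 \<union>\<^sub>g K 2 \<union>\<^sub>g K 1"
  by (rule isomorphicI[of "\<lambda>x. if x = 0 then a else if x = 4 then b else if x = 2 then c else if x = 6 then d else e"]; unfold verts_small mem_nbrs[symmetric] nbrs_small)
    (use assms in \<open>auto simp: bij_betw_def simp del: mem_nbrs\<close>)

lemma isomorphic_K2_K2_K2:
  assumes "verts G = {a, b, c, d, e, f}" "nbrs G a = {b}" "nbrs G b = {a}" "nbrs G c = {d}" "nbrs G d = {c}"
    "nbrs G e = {f}" "nbrs G f = {e}" "distinct [a, b, c, d, e, f]"
  shows "G \<cong>\<^sub>g K 2 \<union>\<^sub>g K 2 \<union>\<^sub>g K 2"
  by (rule isomorphicI[of "\<lambda>x. if x = 0 then a else if x = 4 then b else if x = 2 then c else if x = 6 then d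
      else if x = 1 then e else f"]; unfold verts_small mem_nbrs[symmetric] nbrs_small)
    (use assms in \<open>auto simp: bij_betw_def simp del: mem_nbrs\<close>)

lemma extremal_familyI:
  "2 \<le> m \<Longrightarrow> path_graph m \<in> extremal_family"
  "3 \<le> m \<Longrightarrow> cycle_graph m \<in> extremal_family"
  "H \<in> small_family \<Longrightarrow> H \<in> extremal_family"
  by (auto simp: extremal_family_def)

lemma small_familyI:
  "empty_graph 4 \<in> small_family"
  "K 2 \<union>\<^sub>g K 1 \<in> small_family"
  "K 2 \<union>\<^sub>g K 2 \<in> small_family"
  "K 2 \<union>\<^sub>g K 1 \<union>\<^sub>g K 1 \<in> small_family"
  "K 2 \<union>\<^sub>g K 2 \<union>\<^sub>g K 1 \<in> small_family"
  "K 2 \<union>\<^sub>g K 2 \<union>\<^sub>g K 2 \<in> small_family"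
  by (simp_all add: small_family_def)

text \<open>The three closed neighbourhoods are components, each a \<open>K 1\<close> or
  \<open>K 2\<close>, and they may coincide; the first is a \<open>K 2\<close>. Alone it is the path
  on two vertices.\<close>

lemma degree_1_cases:
  assumes G: "simple_graph G" and deg: "\<And>x. x \<in> verts G \<Longrightarrow> card (nbrs G x) \<le> 1"
    and ab: "adjacent G a b" and cover: "verts G = {a, b} \<union> insert p (nbrs G p) \<union> insert q (nbrs G q)"
  shows "\<exists>H\<in>extremal_family. G \<cong>\<^sub>g H"
proof -
  have single: "nbrs G x = {y}" if "adjacent G x y" for x y
    using that deg adjacent_vertsD(1)[OF G that] by (intro nbrs_eq_singleton[OF G])
  have na: "nbrs G a = {b}" and nb: "nbrs G b = {a}" and ne: "a \<noteq> b"
    using single ab adjacent_sym adjacent_vertsD(3)[OF G ab] by metis+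
  have shape: "\<exists>x'. nbrs G x = {x'} \<and> nbrs G x' = {x} \<and> x' \<noteq> x" if "nbrs G x \<noteq> {}" for x
  proof -
    obtain x' where x': "adjacent G x x'" using \<open>nbrs G x \<noteq> {}\<close> by auto
    then show ?thesis using single adjacent_sym adjacent_vertsD(3)[OF G x'] by metis
  qed
  have two: ?thesis if p: "p \<notin> {a, b}" and V: "verts G = {a, b} \<union> insert p (nbrs G p)" for p
  proof (cases "nbrs G p = {}")
    case True
    then have "G \<cong>\<^sub>g K 2 \<union>\<^sub>g K 1" using p V na nb ne by (intro isomorphic_K2_K1[of G a b p]) auto
    then show ?thesis using extremal_familyI(3) small_familyI by blast
  next
    case False
    then obtain p' where p': "nbrs G p = {p'}" "nbrs G p' = {p}" "p' \<noteq> p" using shape by blast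
    moreover have "p' \<noteq> a" "p' \<noteq> b" using p p'(2) na nb by auto
    ultimately have "G \<cong>\<^sub>g K 2 \<union>\<^sub>g K 2" using p V na nb ne by (intro isomorphic_K2_K2[of G a b p p']) auto
    then show ?thesis using extremal_familyI(3) small_familyI by blast
  qed
  \<comment> \<open>The implication orders \<open>p\<close> and \<open>q\<close> so that an isolated
    vertex comes last, as in the family; the final case uses this fact in both orders.\<close>
  have three: ?thesis if p: "p \<notin> {a, b}" and q: "q \<notin> {a, b}" "q \<notin> insert p (nbrs G p)"
    and V: "verts G = {a, b} \<union> insert p (nbrs G p) \<union> insert q (nbrs G q)" and imp: "nbrs G p = {} \<longrightarrow> nbrs G q = {}"
    for p q
  proof (cases "nbrs G p = {}")
    case True
    then have "G \<cong>\<^sub>g K 2 \<union>\<^sub>g K 1 \<union>\<^sub>g K 1"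
      using p q V imp na nb ne by (intro isomorphic_K2_K1_K1[of G a b p q]) auto
    then show ?thesis using extremal_familyI(3) small_familyI by blast
  next
    case False
    then obtain p' where p': "nbrs G p = {p'}" "nbrs G p' = {p}" "p' \<noteq> p" using shape by blast
    have p'_ne: "p' \<noteq> a" "p' \<noteq> b" "q \<noteq> p'" using p q p'(1,2) na nb by auto
    show ?thesis
    proof (cases "nbrs G q = {}")
      case True
      then have "G \<cong>\<^sub>g K 2 \<union>\<^sub>g K 2 \<union>\<^sub>g K 1"
        using p q V p' p'_ne na nb ne by (intro isomorphic_K2_K2_K1[of G a b p p' q]) auto
      then show ?thesis using extremal_familyI(3) small_familyI by blast
    next
      case False
      then obtain q' where q': "nbrs G q = {q'}" "nbrs G q' = {q}" "q' \<noteq> q" using shape by blast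
      have "q' \<noteq> a" "q' \<noteq> b" "q' \<noteq> p" "q' \<noteq> p'" using p q q'(2) p' na nb by auto
      then have "G \<cong>\<^sub>g K 2 \<union>\<^sub>g K 2 \<union>\<^sub>g K 2"
        using p q V p' p'_ne q' na nb ne by (intro isomorphic_K2_K2_K2[of G a b p p' q q']) auto
      then show ?thesis using extremal_familyI(3) small_familyI by blast
    qed
  qed
  have in_ab: "insert x (nbrs G x) = {a, b}" if "x \<in> {a, b}" for x using that na nb by auto
  consider "p \<in> {a, b}" "q \<in> {a, b}" | "p \<in> {a, b}" "q \<notin> {a, b}" | "p \<notin> {a, b}" "q \<in> {a, b}"
    | "p \<notin> {a, b}" "q \<notin> {a, b}" "q \<in> insert p (nbrs G p)"
    | "p \<notin> {a, b}" "q \<notin> {a, b}" "q \<notin> insert p (nbrs G p)"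
    by blast
  then show ?thesis
  proof cases
    case 1
    then have "verts G = {a, b}" using cover in_ab by auto
    then have "G \<cong>\<^sub>g path_graph 2" using na nb ne by (intro isomorphic_path_2[of G a b]) auto
    then show ?thesis using extremal_familyI(1) by blast
  next
    case 2
    then show ?thesis using two[of q] cover in_ab[of p] by auto
  next
    case 3
    then show ?thesis using two[of p] cover in_ab[of q] by auto
  next
    case 4
    have "insert q (nbrs G q) \<subseteq> insert p (nbrs G p)"
      using adj_closed_nbrs[OF G deg, of p] 4(3) unfolding adj_closed_def by blast
    then have "verts G = {a, b} \<union> insert p (nbrs G p)" using cover by blast
    then show ?thesis using two[OF 4(1)] by blast
  next
    case 5
    have "p \<notin> insert q (nbrs G q)" using 5(3) adjacent_sym by (metis insert_iff mem_nbrs)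
    moreover have "verts G = {a, b} \<union> insert q (nbrs G q) \<union> insert p (nbrs G p)" using cover by blast
    ultimately show ?thesis using three[OF 5] three[OF 5(2,1)] cover by blast
  qed
qed

text \<open>The third claim feeds \<open>dmg_le_edge\<close>, which needs an edge to guard. The only
  member without one gets its upper bound from \<open>dmg_le_edgeless\<close>.\<close>

lemma extremal_family_robbers:
  assumes "H \<in> extremal_family"
  shows "simple_graph H" "robbers_leave H 2"
    "\<lbrakk>H \<noteq> empty_graph 4\<rbrakk> \<Longrightarrow> \<exists>u\<in>verts H. \<exists>v\<in>verts H. adjacent H u v"
proof -
  consider (path) m where "2 \<le> m" "H = path_graph m" | (cycle) m where "3 \<le> m" "H = cycle_graph m"
    | (small) "H \<in> small_family"
    using assms by (auto simp: extremal_family_def)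
  then have "simple_graph H \<and> robbers_leave H 2 \<and>
      (H \<noteq> empty_graph 4 \<longrightarrow> (\<exists>u\<in>verts H. \<exists>v\<in>verts H. adjacent H u v))"
  proof cases
    case path
    then have "0 \<in> verts H \<and> 1 \<in> verts H \<and> adjacent H 0 1" by (simp add: adjacent_path)
    then show ?thesis using path simple_path robbers_leave_path by blast
  next
    case cycle
    then have "0 \<in> verts H \<and> 1 \<in> verts H \<and> adjacent H 0 1" by (simp add: adjacent_cycle)
    moreover have "simple_graph H" using cycle by (simp add: simple_cycle)
    ultimately show ?thesis using cycle robbers_leave_cycle by blast
  next
    case small
    then have "simple_graph H"
      using simple_empty simple_small unfolding small_family_def by blast
    moreover have "H \<noteq> empty_graph 4 \<longrightarrow> (\<exists>u\<in>verts H. \<exists>v\<in>verts H. adjacent H u v)"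
      using small unfolding small_family_def
      by (elim insertE emptyE; hypsubst; simp add: verts_small adjacent_small del: One_nat_def)
    ultimately show ?thesis using robbers_leave_small[OF small] by blast
  qed
  then show "simple_graph H" "robbers_leave H 2"
    "\<lbrakk>H \<noteq> empty_graph 4\<rbrakk> \<Longrightarrow> \<exists>u\<in>verts H. \<exists>v\<in>verts H. adjacent H u v" by blast+
qed

lemma dmg_extremal:
  assumes G: "simple_graph G" and H: "H \<in> extremal_family" and iso: "G \<cong>\<^sub>g H"
  shows "int (dmg G 2) = int (card (verts G)) - 2"
proof -
  obtain f where f: "bij_betw f (verts H) (verts G)"
    "\<And>u v. u \<in> verts H \<Longrightarrow> v \<in> verts H \<Longrightarrow> adjacent G (f u) (f v) \<longleftrightarrow> adjacent H u v"
    using isomorphicE[OF iso] by metis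
  note fam = extremal_family_robbers[OF H]
  have leave: "robbers_leave G 2" by (rule robbers_leave_image[OF G fam(1) f fam(2)])
  show ?thesis
  proof (cases "H = empty_graph 4")
    case True
    have edgeless: "\<not> adjacent G u v" for u v
    proof
      assume uv: "adjacent G u v"
      then have "u \<in> f ` verts H" "v \<in> f ` verts H"
        using adjacent_vertsD[OF G uv] f(1) by (simp_all add: bij_betw_def)
      then show False using uv f(2) True by auto
    qed
    have "card (verts G) = 4" using bij_betw_same_card[OF f(1)] True by simp
    moreover from this have "verts G \<noteq> {}" by auto
    ultimately show ?thesis
      using dmg_ge_robbers_leave[OF G _ leave] dmg_le_edgeless[OF G _ edgeless] by simp
  next
    case False
    then obtain u v where "u \<in> verts H" "v \<in> verts H" "adjacent H u v" using fam(3) by blast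
    then have uv: "adjacent G (f u) (f v)" using f(2) by blast
    have "{f u, f v} \<subseteq> verts G" "f u \<noteq> f v" using adjacent_vertsD[OF G uv] by auto
    then have "2 \<le> card (verts G)" "verts G \<noteq> {}"
      using card_mono[OF finite_verts[OF G], of "{f u, f v}"] by auto
    then show ?thesis using dmg_ge_robbers_leave[OF G _ leave] dmg_le_edge[OF G uv] by simp
  qed
qed

text \<open>With two or three isolated vertices the robbers occupy all but the cop's, which keeps
  these graphs out of the family.\<close>

lemma dmg_edgeless_few:
  assumes G: "simple_graph G" and edgeless: "\<And>u v. \<not> adjacent G u v"
    and card: "2 \<le> card (verts G)" "card (verts G) \<le> 3"
  shows "card (verts G) - 1 \<le> dmg G 2"
proof -
  have nb: "nbrs G x = {}" for x using edgeless by auto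
  have "\<exists>u\<in>verts G. \<exists>w\<in>verts G. u \<noteq> c \<and> w \<noteq> c \<and> card (verts G - {u, w}) \<le> 1" if c: "c \<in> verts G" for c
  proof -
    have "card (verts G - {c}) = 1 \<or> card (verts G - {c}) = 2"
      using card finite_verts[OF G] c by auto
    then obtain u w where uw: "verts G - {c} = {u, w}"
      by (metis card_1_singletonE card_2_iff insert_absorb2)
    have "card (verts G - {u, w}) \<le> 1"
    proof -
      have "verts G - {u, w} \<subseteq> {c}" unfolding uw[symmetric] by blast
      then show ?thesis using card_mono[of "{c}"] by fastforce
    qed
    moreover have "u \<in> verts G - {c}" "w \<in> verts G - {c}" unfolding uw by simp_all
    ultimately show ?thesis by blast
  qed
  then have "robbers_leave G 1"
    by (intro robbers_leave_degree_1[OF G]) (simp_all add: nb insert_commute)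
  moreover have "verts G \<noteq> {}" using card by auto
  ultimately show ?thesis using dmg_ge_robbers_leave[OF G] by blast
qed

lemma extremal_if_dmg:
  assumes G: "simple_graph G" and dmg: "int (dmg G 2) = int (card (verts G)) - 2"
  shows "\<exists>H\<in>extremal_family. G \<cong>\<^sub>g H"
proof -
  let ?n = "card (verts G)"
  have n: "dmg G 2 + 2 = ?n" using dmg by linarith
  consider (three) v where "v \<in> verts G" "3 \<le> card (nbrs G v)"
    | (two) v where "v \<in> verts G" "card (nbrs G v) = 2" "\<And>x. x \<in> verts G \<Longrightarrow> card (nbrs G x) \<le> 2"
    | (one) a b where "adjacent G a b" "\<And>x. x \<in> verts G \<Longrightarrow> card (nbrs G x) \<le> 1"
    | (zero) "\<And>u v. \<not> adjacent G u v"
    by (metis (no_types) One_nat_def Suc_1 le_SucE not_less_eq_eq numeral_3_eq_3)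
  then show ?thesis
  proof cases
    case three
    have "card (insert v (nbrs G v)) \<le> ?n"
      using three(1) nbrs_subset_verts[OF G] by (intro card_mono finite_verts[OF G]) auto
    then show ?thesis
      using dmg_le_degree_3[OF G three] three(2) n by (simp add: card_insert_nbrs[OF G])
  next
    case two
    have "card (insert v (nbrs G v)) \<le> ?n"
      using two(1) nbrs_subset_verts[OF G] by (intro card_mono finite_verts[OF G]) auto
    then have "\<not> dmg G 2 \<le> ?n - 3" using n two(2) by (simp add: card_insert_nbrs[OF G])
    then obtain m where "3 \<le> m" "G \<cong>\<^sub>g path_graph m \<or> G \<cong>\<^sub>g cycle_graph m"
      using degree_2_cases[OF G two(3,1,2)] by blast
    then show ?thesis using extremal_familyI(1,2)[of m] by fastforce
  next
    case one
    have ab: "{a, b} \<subseteq> verts G" "a \<noteq> b" using adjacent_vertsD[OF G one(1)] by auto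
    show ?thesis
    \<comment> \<open>For two vertices \<open>?n - 3\<close> truncates to 0, which equals
      \<open>dmg G 2\<close>, so the strict inequality used below fails.\<close>
    proof (cases "?n = 2")
      case True
      then have "verts G = {a, b}"
        using card_seteq[OF finite_verts[OF G] ab(1)] ab(2) by simp
      moreover have "nbrs G a \<subseteq> verts G" by (rule nbrs_subset_verts[OF G])
      ultimately have "verts G = {a, b} \<union> insert a (nbrs G a) \<union> insert a (nbrs G a)" by blast
      then show ?thesis using degree_1_cases[OF G one(2,1)] by blast
    next
      case False
      then have "?n - 3 < dmg G 2" using n by linarith
      then obtain p q where "verts G = {a, b} \<union> insert p (nbrs G p) \<union> insert q (nbrs G q)"
        using verts_cover_if_dmg_gt[OF G one(2,1)] by metis
      then show ?thesis using degree_1_cases[OF G one(2,1)] by blast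
    qed
  next
    case zero
    \<comment> \<open>Two robbers damage at most two isolated vertices, which forces
      \<open>?n <= 4\<close>; fewer than four vertices would leave only one undamaged.\<close>
    have "verts G \<noteq> {}" using n by auto
    then have "dmg G 2 \<le> 2" by (rule dmg_le_edgeless[OF G _ zero])
    moreover have "\<not> ?n \<le> 3" using dmg_edgeless_few[OF G zero] n by linarith
    ultimately have "?n = 4" using n by linarith
    then have "G \<cong>\<^sub>g empty_graph 4" using isomorphic_edgeless[OF finite_verts[OF G] zero] by simp
    then show ?thesis using extremal_familyI(3) small_familyI(1) by blast
  qed
qed

text \<open>The equation is over the integers: with truncated subtraction the one-vertex graph would
  satisfy it.\<close>

theorem theorem4p1:
  fixes G :: "'a ugraph" and n :: nat
  assumes "simple_graph G" and "card (verts G) = n"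
  shows "int (dmg G 2) = int n - 2 \<longleftrightarrow> (\<exists>H\<in>extremal_family. G \<cong>\<^sub>g H)"
  using dmg_extremal[OF assms(1)] extremal_if_dmg[OF assms(1)] assms(2) by blast

end
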